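(* Let $A$ be an $m \times n$ matrix with non-negative entries and let $b \in \mathbb{R}^m$ be a vector with non-negative entries. Suppose there exists a $k$-sparse vector $x^{*} \in \mathbb{R}^n$ with non-negative entries such that $\|Ax^{*}\|_1 = \|b\|_1$ and $Ax^{*} \le (1+\epsilon_0) b$ (entrywise), for some $0 < \epsilon_0 < 1/16$. Then for any $\epsilon \ge 16\epsilon_0$, there is an efficient algorithm that, given $A$, $b$, $k$ and $\epsilon$, produces a vector $x_{\text{alg}}$ with at most $O(k/\epsilon^3)$ nonzero entries satisfying $\|A x_{\text{alg}} - b\|_1 \le \epsilon \|b\|_1$.
   Context: A vector is $k$-sparse if it has at most $k$ nonzero entries. For vectors $x,y$, $x \le y$ means entrywise inequality. *)

theory Defs
  imports "Jordan_Normal_Form.Matrix" "HOL-Computational_Algebra.Polynomial"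
begin

section \<open>Sparse vectors and the 1-norm\<close>

definition nnz :: "real vec \<Rightarrow> nat" where
  "nnz x = card {i. i < dim_vec x \<and> x $ i \<noteq> 0}"

definition sparse :: "nat \<Rightarrow> real vec \<Rightarrow> bool" where
  "sparse k x \<longleftrightarrow> nnz x \<le> k"

definition norm1 :: "real vec \<Rightarrow> real" where
  "norm1 x = (\<Sum>i<dim_vec x. \<bar>x $ i\<bar>)"

section \<open>Real RAM programs\<close>

text \<open>
  Algorithms on real data are while programs over a real random access machine. The memory consists
  of registers holding natural numbers (used for counting and addressing) and of two-dimensional
  arrays of exact real numbers. Vectors live in the first column of an array and scalars in its
  cell (0,0). The machine can add, subtract, multiply and divide reals, compare them, and cast a
  natural number to a real. There is no rounding, no root or transcendental function, no access to
  the digits of a real, and there are no real constants in programs.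
\<close>

type_synonym name = string
type_synonym state = "(name \<Rightarrow> nat) \<times> (name \<Rightarrow> nat \<Rightarrow> nat \<Rightarrow> real)"

datatype nexp = NConst nat | NVar name | NPlus nexp nexp | NMinus nexp nexp

datatype rexp = OfNat nexp | Cell name nexp nexp
  | RPlus rexp rexp | RMinus rexp rexp | RTimes rexp rexp | RDiv rexp rexp

datatype bexp = NLess nexp nexp | RLess rexp rexp | BNot bexp | BAnd bexp bexp

datatype com = Skip
  | NAssign name nexp
  | RAssign name nexp nexp rexp
  | Seq com com
  | Cond bexp com com
  | While bexp com

text \<open>Subtraction of natural numbers is truncated, and division of a real by zero yields zero.\<close>

fun nval :: "nexp \<Rightarrow> state \<Rightarrow> nat" where
  "nval (NConst c) s = c"
| "nval (NVar v) s = fst s v"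
| "nval (NPlus a b) s = nval a s + nval b s"
| "nval (NMinus a b) s = nval a s - nval b s"

fun rval :: "rexp \<Rightarrow> state \<Rightarrow> real" where
  "rval (OfNat a) s = real (nval a s)"
| "rval (Cell v a b) s = snd s v (nval a s) (nval b s)"
| "rval (RPlus a b) s = rval a s + rval b s"
| "rval (RMinus a b) s = rval a s - rval b s"
| "rval (RTimes a b) s = rval a s * rval b s"
| "rval (RDiv a b) s = rval a s / rval b s"

fun bval :: "bexp \<Rightarrow> state \<Rightarrow> bool" where
  "bval (NLess a b) s \<longleftrightarrow> nval a s < nval b s"
| "bval (RLess a b) s \<longleftrightarrow> rval a s < rval b s"
| "bval (BNot p) s \<longleftrightarrow> \<not> bval p s"
| "bval (BAnd p q) s \<longleftrightarrow> bval p s \<and> bval q s"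

definition nupd :: "name \<Rightarrow> nat \<Rightarrow> state \<Rightarrow> state" where
  "nupd v c s = ((fst s)(v := c), snd s)"

definition rupd :: "name \<Rightarrow> nat \<Rightarrow> nat \<Rightarrow> real \<Rightarrow> state \<Rightarrow> state" where
  "rupd v i j r s = (fst s, (snd s)(v := (snd s v)(i := (snd s v i)(j := r))))"

text \<open>
  \<open>exec c s t s'\<close>: started in state \<open>s\<close>, the program \<open>c\<close> halts after \<open>t\<close> steps in state \<open>s'\<close>. Every
  assignment and every test counts as one step; since the expressions of a program do not depend on
  its input, charging for each single operation would change \<open>t\<close> by at most a constant factor.
\<close>

inductive exec :: "com \<Rightarrow> state \<Rightarrow> nat \<Rightarrow> state \<Rightarrow> bool" where
  Skip: "exec Skip s 1 s"
| NAssign: "exec (NAssign v a) s 1 (nupd v (nval a s) s)"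
| RAssign: "exec (RAssign v a b e) s 1 (rupd v (nval a s) (nval b s) (rval e s) s)"
| Seq: "exec c1 s1 t1 s2 \<Longrightarrow> exec c2 s2 t2 s3 \<Longrightarrow> exec (Seq c1 c2) s1 (t1 + t2) s3"
| CondTrue: "bval p s \<Longrightarrow> exec c1 s t s' \<Longrightarrow> exec (Cond p c1 c2) s (1 + t) s'"
| CondFalse: "\<not> bval p s \<Longrightarrow> exec c2 s t s' \<Longrightarrow> exec (Cond p c1 c2) s (1 + t) s'"
| WhileFalse: "\<not> bval p s \<Longrightarrow> exec (While p c) s 1 s"
| WhileTrue: "bval p s1 \<Longrightarrow> exec c s1 t1 s2 \<Longrightarrow> exec (While p c) s2 t2 s3
    \<Longrightarrow> exec (While p c) s1 (1 + t1 + t2) s3"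

lemma exec_deterministic:
  assumes "exec c s t s'" and "exec c s u s''"
  shows "u = t \<and> s'' = s'"
  using assms
proof (induction arbitrary: u s'' rule: exec.induct)
  case (Skip s)
  then show ?case by cases simp
next
  case (NAssign v a s)
  then show ?case by cases simp
next
  case (RAssign v a b e s)
  then show ?case by cases simp
next
  case prem: (Seq c1 s1 t1 s2 c2 t2 s3)
  from prem.prems show ?case
  proof cases
    case (Seq u1 r u2)
    from prem.IH(1)[OF Seq(2)] have r: "u1 = t1" "r = s2" by blast+
    from prem.IH(2)[OF Seq(3)[unfolded r(2)]] r(1) Seq(1) show ?thesis by blast
  qed
next
  case prem: (CondTrue p s c1 t s' c2)
  from prem.prems show ?case
  proof cases
    case (CondTrue u1)
    with prem.IH[OF CondTrue(3)] show ?thesis by blast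
  next
    case CondFalse
    with prem.hyps show ?thesis by blast
  qed
next
  case prem: (CondFalse p s c2 t s' c1)
  from prem.prems show ?case
  proof cases
    case (CondFalse u1)
    with prem.IH[OF CondFalse(3)] show ?thesis by blast
  next
    case CondTrue
    with prem.hyps show ?thesis by blast
  qed
next
  case (WhileFalse p s c)
  from WhileFalse.prems show ?case
    by cases (use WhileFalse.hyps in simp_all)
next
  case prem: (WhileTrue p s1 c t1 s2 t2 s3)
  from prem.prems show ?case
  proof cases
    case WhileFalse
    with prem.hyps show ?thesis by blast
  next
    case (WhileTrue u1 r u2)
    from prem.IH(1)[OF WhileTrue(3)] have r: "u1 = t1" "r = s2" by blast+
    from prem.IH(2)[OF WhileTrue(4)[unfolded r(2)]] r(1) WhileTrue(1) show ?thesis by blast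
  qed
qed

section \<open>Input and output\<close>

text \<open>All memory outside the input is zero initially.\<close>

definition input_state :: "real mat \<Rightarrow> real vec \<Rightarrow> nat \<Rightarrow> real \<Rightarrow> state" where
  "input_state A b k \<epsilon> =
     ((\<lambda>_. 0)(''m'' := dim_row A, ''n'' := dim_col A, ''k'' := k),
      (\<lambda>_ _ _. 0)(
        ''A'' := (\<lambda>i j. if i < dim_row A \<and> j < dim_col A then A $$ (i, j) else 0),
        ''b'' := (\<lambda>i j. if i < dim_vec b \<and> j = 0 then b $ i else 0),
        ''eps'' := (\<lambda>i j. if i = 0 \<and> j = 0 then \<epsilon> else 0)))"

definition output_vec :: "nat \<Rightarrow> state \<Rightarrow> real vec" where
  "output_vec n s = vec n (\<lambda>j. snd s ''x'' j 0)"

end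

theory Submission
  imports Defs
begin

text \<open>
  Scale so that \<open>\<parallel>b\<parallel> = 1\<close> and every column of \<open>A\<close> has norm 1; then \<open>p = A x\<close> ranges over a convex
  hull of columns and \<open>\<parallel>p - b\<parallel>\<close> is twice the sum of the positive parts of \<open>p\<^sub>i - b\<^sub>i\<close>. The Frank-Wolfe method
  is applied to the one-sided quadratic objective \<open>F p = \<Sum> b\<^sub>i (max 0 (p\<^sub>i / b\<^sub>i - 1))\<^sup>2\<close>; each round uses
  one column, so the number of rounds bounds the support. One-sidedness makes \<open>F\<close> of order \<open>\<epsilon>\<^sup>2\<close> at the
  sparse solution, although its two-sided counterpart may be of order \<open>\<epsilon>\<close>. Only columns with
  \<open>a\<^sub>i\<^sub>j \<le> L b\<^sub>i\<close> for \<open>L = 32 k / \<epsilon>\<close> are used: they bound the curvature of \<open>F\<close> by \<open>O(L)\<close>, and dropping the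
  others costs the sparse solution only a fraction \<open>\<epsilon> / 16\<close> of its mass. After \<open>O(L / \<epsilon>\<^sup>2) = O(k / \<epsilon>\<^sup>3)\<close>
  rounds \<open>F\<close> is at most \<open>\<epsilon>\<^sup>2 / 4\<close>. For \<open>\<epsilon> \<ge> 1\<close> the zero vector is good enough.
\<close>

section \<open>The one-sided quadratic penalty\<close>

text \<open>At \<open>\<beta> = 0\<close> the division default makes the value 0, so rows with
  \<open>b i = 0\<close> carry no penalty; eligibility of the columns forces \<open>p i = 0\<close>
  there instead.\<close>

definition excess :: "real \<Rightarrow> real \<Rightarrow> real" where
  "excess \<beta> p = max 0 (p / \<beta> - 1)"

lemma excess_nonneg: "0 \<le> excess \<beta> p"
  by (simp add: excess_def)

lemma excess_le_scaled:
  assumes "0 \<le> \<beta>" "0 \<le> \<delta>" "p \<le> (1 + \<delta>) * \<beta>"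
  shows "excess \<beta> p \<le> \<delta>"
  using assms by (cases "\<beta> = 0") (auto simp: excess_def field_simps)

text \<open>The square of the positive part has the 2-Lipschitz derivative
  \<open>2 * max 0 s\<close>, hence a quadratic upper bound with remainder \<open>r\<^sup>2\<close>.
  Rescaling by \<beta> turns the remainder into \<open>h\<^sup>2 / \<beta>\<close>.\<close>

lemma excess_sq_smooth:
  fixes \<beta> p h :: real
  assumes "0 < \<beta>"
  shows "\<beta> * (excess \<beta> (p + h))\<^sup>2 \<le> \<beta> * (excess \<beta> p)\<^sup>2 + 2 * excess \<beta> p * h + h\<^sup>2 / \<beta>"
proof -
  define s where "s = p / \<beta> - 1"
  define r where "r = h / \<beta>"
  have "(max 0 (s + r))\<^sup>2 \<le> (max 0 s)\<^sup>2 + 2 * max 0 s * r + r\<^sup>2"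
  proof (cases "s \<ge> 0")
    case True
    then have "(max 0 s)\<^sup>2 + 2 * max 0 s * r + r\<^sup>2 = (s + r)\<^sup>2"
      by (simp add: power2_eq_square algebra_simps)
    then show ?thesis by (simp add: max_def)
  next
    case False
    then have "\<bar>max 0 (s + r)\<bar> \<le> \<bar>r\<bar>" by auto
    then have "(max 0 (s + r))\<^sup>2 \<le> r\<^sup>2" by (simp only: abs_le_square_iff)
    then show ?thesis using False by (simp add: max_def)
  qed
  then have "\<beta> * (max 0 (s + r))\<^sup>2 \<le> \<beta> * ((max 0 s)\<^sup>2 + 2 * max 0 s * r + r\<^sup>2)"
    using assms by (intro mult_left_mono) auto
  also have "\<dots> = \<beta> * (max 0 s)\<^sup>2 + 2 * max 0 s * h + h\<^sup>2 / \<beta>"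
    using assms by (simp add: r_def algebra_simps power2_eq_square)
  finally show ?thesis
    unfolding excess_def by (simp add: s_def r_def add_divide_distrib algebra_simps)
qed

text \<open>A convex function lies above its tangents. For \<open>s >= 0\<close> this is
  \<open>(max 0 r - s)\<^sup>2 >= 0\<close> combined with \<open>r <= max 0 r\<close>; for negative
  \<open>s\<close> the tangent is zero.\<close>

lemma excess_sq_convex:
  fixes \<beta> p q :: real
  assumes "0 < \<beta>"
  shows "\<beta> * (excess \<beta> p)\<^sup>2 + 2 * excess \<beta> p * (q - p) \<le> \<beta> * (excess \<beta> q)\<^sup>2"
proof -
  define s where "s = p / \<beta> - 1"
  define r where "r = q / \<beta> - 1"
  have "(max 0 s)\<^sup>2 + 2 * max 0 s * (r - s) \<le> (max 0 r)\<^sup>2"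
  proof (cases "s \<ge> 0")
    case True
    have "(max 0 r)\<^sup>2 - (s\<^sup>2 + 2 * s * (r - s)) \<ge> (max 0 r - s)\<^sup>2"
    proof -
      have "2 * s * r \<le> 2 * s * max 0 r" using True by (intro mult_left_mono) auto
      then show ?thesis by (simp add: power2_eq_square algebra_simps)
    qed
    moreover have "0 \<le> (max 0 r - s)\<^sup>2" by simp
    ultimately have "s\<^sup>2 + 2 * s * (r - s) \<le> (max 0 r)\<^sup>2" by linarith
    then show ?thesis using True by (simp add: max_absorb2)
  qed (simp add: max_def)
  then have "\<beta> * ((max 0 s)\<^sup>2 + 2 * max 0 s * (r - s)) \<le> \<beta> * (max 0 r)\<^sup>2"
    using assms by (intro mult_left_mono) auto
  moreover have "\<beta> * (r - s) = q - p"
    using assms by (simp add: r_def s_def algebra_simps)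
  then have "\<beta> * ((max 0 s)\<^sup>2 + 2 * max 0 s * (r - s)) = \<beta> * (max 0 s)\<^sup>2 + 2 * max 0 s * (q - p)"
    by (simp add: algebra_simps flip: \<open>\<beta> * (r - s) = q - p\<close>)
  ultimately show ?thesis unfolding excess_def by (simp add: s_def r_def)
qed

section \<open>Convergence of the Frank-Wolfe iteration\<close>

text \<open>This locale carries data only, so that the program can also be run through when
  \<epsilon> >= 1 or b = 0, where the assumptions of \<open>sparse_system\<close> fail.\<close>

locale nonneg_system =
  fixes m n K :: nat and a :: "nat \<Rightarrow> nat \<Rightarrow> real" and b :: "nat \<Rightarrow> real" and \<epsilon> :: real
begin

definition total :: real where "total = (\<Sum>i<m. b i)"

definition colsum :: "nat \<Rightarrow> real" where "colsum j = (\<Sum>i<m. a i j)"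

text \<open>Every column carrying at least a fraction \<open>\<epsilon> / (16 K)\<close> of the mass of the sparse solution
  satisfies this.\<close>

definition eligible :: "nat \<Rightarrow> bool" where
  "eligible j \<longleftrightarrow> 0 < colsum j \<and> (\<forall>i<m. a i j * total * \<epsilon> \<le> 32 * real K * colsum j * b i)"

definition objective :: "(nat \<Rightarrow> real) \<Rightarrow> real" where
  "objective p = (\<Sum>i<m. b i * (excess (b i) (p i))\<^sup>2)"

definition score :: "(nat \<Rightarrow> real) \<Rightarrow> nat \<Rightarrow> real" where
  "score p j = (\<Sum>i<m. excess (b i) (p i) * a i j) / colsum j"

text \<open>The first summand in the bound on the objective is its value at the rescaled sparse solution,
  the second is the Frank-Wolfe rate \<open>8 L total / (t + 2)\<close> with \<open>L = 32 K / \<epsilon>\<close>.\<close>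

definition iterate :: "nat \<Rightarrow> (nat \<Rightarrow> real) \<Rightarrow> (nat \<Rightarrow> real) \<Rightarrow> bool" where
  "iterate t x p \<longleftrightarrow>
     (\<forall>i<m. p i = (\<Sum>j<n. a i j * x j)) \<and>
     (\<forall>j<n. 0 \<le> x j \<and> (\<not> eligible j \<longrightarrow> x j = 0)) \<and>
     (\<Sum>j<n. colsum j * x j) = (if t = 0 then 0 else total) \<and>
     card {j. j < n \<and> x j \<noteq> 0} \<le> t \<and>
     objective p \<le> (2 * \<epsilon> / 15)\<^sup>2 * total + 256 * real K / \<epsilon> * total / (real t + 2)"

end

text \<open>Nonnegativity is assumed at all indices because the matrix and the vector get extended
  by zero. For nonnegative data, equality of the 1-norms becomes the linear condition
  \<open>x0_mass\<close>.\<close>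

locale sparse_system = nonneg_system +
  fixes x0 :: "nat \<Rightarrow> real" and \<epsilon>0 :: real
  assumes a_nonneg: "\<And>i j. 0 \<le> a i j"
    and b_nonneg: "\<And>i. 0 \<le> b i"
    and total_pos: "0 < total"
    and eps: "0 < \<epsilon>" "\<epsilon> < 1" "0 \<le> \<epsilon>0" "16 * \<epsilon>0 \<le> \<epsilon>"
    and x0_nonneg: "\<And>j. j < n \<Longrightarrow> 0 \<le> x0 j"
    and x0_sparse: "card {j. j < n \<and> x0 j \<noteq> 0} \<le> K"
    and x0_mass: "(\<Sum>j<n. colsum j * x0 j) = total"
    and x0_le: "\<And>i. i < m \<Longrightarrow> (\<Sum>j<n. a i j * x0 j) \<le> (1 + \<epsilon>0) * b i"
begin

section \<open>Restricting the sparse solution to eligible columns\<close>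

lemma colsum_nonneg: "0 \<le> colsum j"
  unfolding colsum_def by (intro sum_nonneg a_nonneg)

lemma K_pos: "0 < K"
proof (rule ccontr)
  assume "\<not> 0 < K"
  with x0_sparse have "card {j. j < n \<and> x0 j \<noteq> 0} = 0" by simp
  then have "{j. j < n \<and> x0 j \<noteq> 0} = {}" by simp
  then have "(\<Sum>j<n. colsum j * x0 j) = 0" by (intro sum.neutral) auto
  then show False using x0_mass total_pos by simp
qed

lemma mass_eq_colsum: 
  "(\<Sum>i<m. \<Sum>j<n. a i j * x j) = (\<Sum>j<n. colsum j * x j)"
  by (subst sum.swap) (simp add: colsum_def sum_distrib_right)

lemma eligible_entry_le:
  assumes "eligible j" "i < m"
  shows "a i j * total \<le> 32 * real K / \<epsilon> * colsum j * b i"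
  using assms eps(1) by (simp add: eligible_def field_simps)

text \<open>A single column contributes at most the whole row sum, so
  \<open>a i j * x0 j <= (1 + \<epsilon>0) * b i <= 2 * b i\<close>. Inserting the lower bound on
  the mass of column \<open>j\<close> gives the factor 32 = 2 * 16.\<close>

lemma heavy_eligible:
  assumes j: "j < n" and heavy: "\<epsilon> * total / (16 * real K) \<le> colsum j * x0 j"
  shows "eligible j"
proof -
  have pos: "0 < \<epsilon> * total / (16 * real K)" using eps total_pos K_pos by simp
  then have "colsum j \<noteq> 0" using heavy by auto
  then have cj: "0 < colsum j" using colsum_nonneg[of j] by simp
  moreover have "a i j * total * \<epsilon> \<le> 32 * real K * colsum j * b i" if i: "i < m" for i
  proof -
    have "a i j * x0 j \<le> (\<Sum>j<n. a i j * x0 j)"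
      using j by (intro member_le_sum) (auto intro: mult_nonneg_nonneg a_nonneg x0_nonneg)
    also have "\<dots> \<le> (1 + \<epsilon>0) * b i" using x0_le[OF i] .
    also have "\<dots> \<le> 2 * b i" using eps by (intro mult_right_mono b_nonneg) auto
    finally have 1: "a i j * x0 j \<le> 2 * b i" .
    have "a i j * (\<epsilon> * total / (16 * real K)) \<le> a i j * (colsum j * x0 j)"
      by (intro mult_left_mono heavy a_nonneg)
    also have "\<dots> = colsum j * (a i j * x0 j)" by simp
    also have "\<dots> \<le> colsum j * (2 * b i)" using 1 cj by (intro mult_left_mono) auto
    finally show ?thesis using K_pos by (simp add: field_simps)
  qed
  ultimately show ?thesis by (simp add: eligible_def)
qed

text \<open>At most \<open>K\<close> nonzero entries are light, each of mass below
  \<open>\<epsilon> * total / (16 * K)\<close>, so dropping them loses at most a fraction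
  \<epsilon>/16. Rescaling the heavy entries by \<open>total / S\<close> restores the mass and
  raises the rows only slightly.\<close>

lemma eligible_solution:
  "\<exists>z. (\<forall>j<n. 0 \<le> z j \<and> (\<not> eligible j \<longrightarrow> z j = 0)) \<and> (\<Sum>j<n. colsum j * z j) = total \<and>
    (\<forall>i<m. (\<Sum>j<n. a i j * z j) \<le> (1 + 2 * \<epsilon> / 15) * b i)"
proof -
  define \<theta> where "\<theta> = \<epsilon> * total / (16 * real K)"
  define H where "H = {j. j < n \<and> \<theta> \<le> colsum j * x0 j}"
  define N where "N = {j. j < n \<and> x0 j \<noteq> 0}"
  define S where "S = (\<Sum>j\<in>H. colsum j * x0 j)"
  have \<theta>: "0 < \<theta>" using eps total_pos K_pos by (simp add: \<theta>_def)
  have H: "H \<subseteq> N" "N \<subseteq> {..<n}" using \<theta> by (auto simp: H_def N_def)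
  have fin: "finite N" "finite H" by (simp_all add: H_def N_def)
  have "total = (\<Sum>j\<in>N. colsum j * x0 j)"
    unfolding x0_mass[symmetric] using H(2) by (intro sum.mono_neutral_right) (auto simp: N_def)
  also have "\<dots> = S + (\<Sum>j\<in>N - H. colsum j * x0 j)"
    unfolding S_def using sum.subset_diff[OF H(1) fin(1)] by (simp add: add.commute)
  also have "(\<Sum>j\<in>N - H. colsum j * x0 j) \<le> (\<Sum>j\<in>N - H. \<theta>)"
    by (intro sum_mono) (auto simp: H_def N_def)
  also have "(\<Sum>j\<in>N - H. \<theta>) \<le> real K * \<theta>"
  proof -
    have "card (N - H) \<le> card N" using fin by (intro card_mono) auto
    then have "real (card (N - H)) \<le> real K" using x0_sparse by (simp add: N_def)
    then show ?thesis using \<theta> by (simp add: mult_right_mono)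
  qed
  also have "real K * \<theta> = \<epsilon> / 16 * total" using K_pos by (simp add: \<theta>_def)
  finally have S: "(1 - \<epsilon> / 16) * total \<le> S" by (simp add: algebra_simps)
  have Spos: "0 < S"
    using less_le_trans[OF _ S] eps total_pos by simp
  define z where "z j = (if j \<in> H then x0 j * (total / S) else 0)" for j
  have sumz: "(\<Sum>j<n. f j * z j) = (\<Sum>j\<in>H. f j * x0 j) * (total / S)" for f
  proof -
    have "(\<Sum>j<n. f j * z j) = (\<Sum>j\<in>H. f j * z j)"
      using H by (intro sum.mono_neutral_right) (auto simp: z_def)
    also have "\<dots> = (\<Sum>j\<in>H. f j * x0 j) * (total / S)"
      unfolding sum_distrib_right by (intro sum.cong) (auto simp: z_def)
    finally show ?thesis .
  qed
  show ?thesis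
  proof (intro exI[of _ z] conjI allI impI)
    show "0 \<le> z j" if "j < n" for j
      using x0_nonneg[OF that] Spos total_pos by (simp add: z_def)
    show "z j = 0" if "j < n" "\<not> eligible j" for j
      using heavy_eligible[of j] that by (auto simp: z_def H_def \<theta>_def)
    show "(\<Sum>j<n. colsum j * z j) = total"
      using Spos by (simp add: sumz flip: S_def)
    show "(\<Sum>j<n. a i j * z j) \<le> (1 + 2 * \<epsilon> / 15) * b i" if i: "i < m" for i
    proof -
      have "(\<Sum>j\<in>H. a i j * x0 j) \<le> (\<Sum>j<n. a i j * x0 j)"
        using H by (intro sum_mono2) (auto intro: mult_nonneg_nonneg a_nonneg x0_nonneg)
      also have "\<dots> \<le> (1 + \<epsilon>0) * b i" using x0_le[OF i] .
      finally have "(\<Sum>j\<in>H. a i j * x0 j) * total \<le> (1 + \<epsilon>0) * b i * total"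
        using total_pos by (intro mult_right_mono) auto
      also have "\<dots> \<le> (1 + 2 * \<epsilon> / 15) * (1 - \<epsilon> / 16) * (b i * total)"
      proof -
        \<comment> \<open>With this bound the product is at least 1 + \<epsilon>/16, hence at least
          1 + \<epsilon>0. The constant 2/15 makes the first bound sharp at \<epsilon> = 1, since
          17/15 * 15/16 = 17/16.\<close>
        have "\<epsilon> * \<epsilon> \<le> \<epsilon>" using eps by (simp add: mult_left_le_one_le)
        moreover have "(1 + 2 * \<epsilon> / 15) * (1 - \<epsilon> / 16) = 1 + 17 / 240 * \<epsilon> - \<epsilon> * \<epsilon> / 120"
          by (simp add: field_simps)
        ultimately have "1 + \<epsilon>0 \<le> (1 + 2 * \<epsilon> / 15) * (1 - \<epsilon> / 16)"
          using eps by linarith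
        then have "(1 + \<epsilon>0) * (b i * total) \<le> (1 + 2 * \<epsilon> / 15) * (1 - \<epsilon> / 16) * (b i * total)"
          using b_nonneg[of i] total_pos by (intro mult_right_mono) auto
        then show ?thesis by (simp only: mult.assoc)
      qed
      also have "\<dots> = (1 + 2 * \<epsilon> / 15) * b i * ((1 - \<epsilon> / 16) * total)" by simp
      also have "\<dots> \<le> (1 + 2 * \<epsilon> / 15) * b i * S"
        using S b_nonneg[of i] eps by (intro mult_left_mono) auto
      finally have "(\<Sum>j\<in>H. a i j * x0 j) * total / S \<le> (1 + 2 * \<epsilon> / 15) * b i"
        using Spos by (simp only: pos_divide_le_eq)
      then show ?thesis by (simp only: sumz times_divide_eq_right)
    qed
  qed
qed

lemma ex_eligible: "\<exists>j<n. eligible j"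
proof (rule ccontr)
  assume no: "\<not> ?thesis"
  from eligible_solution obtain z where z: "\<And>j. j < n \<Longrightarrow> \<not> eligible j \<Longrightarrow> z j = 0"
    "(\<Sum>j<n. colsum j * z j) = total" by blast
  have "(\<Sum>j<n. colsum j * z j) = 0" using no z(1) by (intro sum.neutral) auto
  then show False using z(2) total_pos by simp
qed

section \<open>The invariant of the iterates and the rate of convergence\<close>

lemma iterate_init: "iterate 0 (\<lambda>_. 0) (\<lambda>_. 0)"
proof -
  have "excess (b i) 0 = 0" for i using b_nonneg[of i] by (simp add: excess_def)
  then show ?thesis using total_pos eps by (simp add: iterate_def objective_def)
qed

text \<open>An iterate is a nonnegative combination of eligible columns of total mass at most
  \<open>total\<close>, so it inherits their entrywise bound. In particular it vanishes wherever
  \<open>b\<close> does.\<close>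

lemma iterate_bound:
  assumes "iterate t x p" "i < m"
  shows "0 \<le> p i" "p i \<le> 32 * real K / \<epsilon> * b i"
proof -
  have p: "p i = (\<Sum>j<n. a i j * x j)" using assms by (simp add: iterate_def)
  have x: "\<And>j. j < n \<Longrightarrow> 0 \<le> x j \<and> (\<not> eligible j \<longrightarrow> x j = 0)"
    using assms by (simp add: iterate_def)
  show "0 \<le> p i" unfolding p using x by (intro sum_nonneg mult_nonneg_nonneg a_nonneg) auto
  have "p i * total = (\<Sum>j<n. (a i j * total) * x j)"
    unfolding p sum_distrib_right by (intro sum.cong) auto
  also have "\<dots> \<le> (\<Sum>j<n. (32 * real K / \<epsilon> * colsum j * b i) * x j)"
  proof (intro sum_mono)
    fix j assume "j \<in> {..<n}"
    then show "(a i j * total) * x j \<le> (32 * real K / \<epsilon> * colsum j * b i) * x j"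
      using x[of j] eligible_entry_le[of j i] assms(2)
      by (cases "eligible j") (auto intro!: mult_right_mono simp del: times_divide_eq_left)
  qed
  also have "\<dots> = 32 * real K / \<epsilon> * b i * (\<Sum>j<n. colsum j * x j)"
    unfolding sum_distrib_left by (intro sum.cong) auto
  also have "\<dots> \<le> 32 * real K / \<epsilon> * b i * total"
    using assms(1) b_nonneg[of i] eps total_pos
    by (intro mult_left_mono) (auto simp: iterate_def)
  finally show "p i \<le> 32 * real K / \<epsilon> * b i"
    using total_pos by (simp only: mult_le_cancel_right_pos)
qed

lemma iterate_mass:
  assumes "iterate t x p"
  shows "(\<Sum>i<m. p i) = (if t = 0 then 0 else total)"
  using assms mass_eq_colsum[of x] by (simp add: iterate_def)

text \<open>A linear functional on a convex hull is minimal at a vertex: the weights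
  \<open>colsum j * z j\<close> add up to \<open>total\<close>, and every score they average is at
  least the score of \<open>h\<close>.\<close>

lemma score_minimizer_le:
  assumes h: "eligible h" and hmin: "\<And>j. j < n \<Longrightarrow> eligible j \<Longrightarrow> score p h \<le> score p j"
    and z: "\<And>j. j < n \<Longrightarrow> 0 \<le> z j" "\<And>j. j < n \<Longrightarrow> \<not> eligible j \<Longrightarrow> z j = 0"
      "(\<Sum>j<n. colsum j * z j) = total"
  shows "(\<Sum>i<m. excess (b i) (p i) * (total / colsum h * a i h))
    \<le> (\<Sum>i<m. excess (b i) (p i) * (\<Sum>j<n. a i j * z j))"
proof -
  have "(\<Sum>i<m. excess (b i) (p i) * (total / colsum h * a i h)) = total * score p h"
    unfolding score_def sum_distrib_left sum_divide_distrib by (intro sum.cong) auto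
  also have "\<dots> = (\<Sum>j<n. colsum j * z j * score p h)"
    by (simp add: z(3)[symmetric] sum_distrib_right)
  also have "\<dots> \<le> (\<Sum>j<n. z j * (\<Sum>i<m. excess (b i) (p i) * a i j))"
  proof (intro sum_mono)
    fix j assume "j \<in> {..<n}"
    then have j: "j < n" by simp
    show "colsum j * z j * score p h \<le> z j * (\<Sum>i<m. excess (b i) (p i) * a i j)"
    proof (cases "eligible j")
      case True
      then have c: "0 < colsum j" by (simp add: eligible_def)
      have "colsum j * z j * score p h \<le> colsum j * z j * score p j"
        using hmin[OF j True] z(1)[OF j] c by (intro mult_left_mono) auto
      then show ?thesis using c by (simp add: score_def)
    qed (use z(2)[OF j] in simp)
  qed
  also have "\<dots> = (\<Sum>i<m. excess (b i) (p i) * (\<Sum>j<n. a i j * z j))"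
    unfolding sum_distrib_left by (subst sum.swap) (simp add: algebra_simps)
  finally show ?thesis .
qed

text \<open>Smoothness bounds the move from \<open>p\<close> towards the vertex \<open>d\<close>,
  and convexity compares \<open>p\<close> with the eligible solution \<open>q\<close>, whose
  objective is of order \<epsilon>^2. The choice of \<open>h\<close> makes the linear term of
  \<open>d\<close> at most that of \<open>q\<close>.\<close>

lemma objective_step:
  assumes it: "iterate t x p" and h: "eligible h"
    and hmin: "\<And>j. j < n \<Longrightarrow> eligible j \<Longrightarrow> score p h \<le> score p j"
    and \<gamma>: "0 \<le> \<gamma>" "\<gamma> \<le> 1"
    and p': "\<And>i. i < m \<Longrightarrow> p' i = (1 - \<gamma>) * p i + \<gamma> * total / colsum h * a i h"
  shows "objective p' \<le> (1 - \<gamma>) * objective p + \<gamma> * ((2 * \<epsilon> / 15)\<^sup>2 * total)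
    + \<gamma>\<^sup>2 * (64 * real K / \<epsilon> * total)"
proof -
  define L where "L = 32 * real K / \<epsilon>"
  define d where "d i = total / colsum h * a i h" for i
  define w where "w i = excess (b i) (p i)" for i
  obtain z where z: "\<And>j. j < n \<Longrightarrow> 0 \<le> z j" "\<And>j. j < n \<Longrightarrow> \<not> eligible j \<Longrightarrow> z j = 0"
    "(\<Sum>j<n. colsum j * z j) = total"
    "\<And>i. i < m \<Longrightarrow> (\<Sum>j<n. a i j * z j) \<le> (1 + 2 * \<epsilon> / 15) * b i"
    using eligible_solution by blast
  define q where "q i = (\<Sum>j<n. a i j * z j)" for i
  have ch: "0 < colsum h" using h by (simp add: eligible_def)
  have L0: "0 \<le> L" using eps by (simp add: L_def)
  have d0: "0 \<le> d i" for i using ch a_nonneg[of i h] total_pos by (simp add: d_def)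
  have dL: "d i \<le> L * b i" if "i < m" for i
  proof -
    have "a i h * total \<le> L * b i * colsum h"
      using eligible_entry_le[OF h that] by (simp add: L_def mult_ac)
    then have "a i h * total / colsum h \<le> L * b i"
      using ch by (simp only: pos_divide_le_eq)
    then show ?thesis by (simp add: d_def mult.commute)
  qed
  have d_sum: "(\<Sum>i<m. d i) = total"
    unfolding d_def sum_distrib_left[symmetric] colsum_def[symmetric] using ch by simp
  have pointwise: "b i * (excess (b i) (p' i))\<^sup>2 \<le> (1 - \<gamma>) * (b i * (w i)\<^sup>2)
      + \<gamma> * (b i * (excess (b i) (q i))\<^sup>2) + 2 * \<gamma> * (w i * d i - w i * q i) + \<gamma>\<^sup>2 * (L * (d i + p i))"
    if i: "i < m" for i
  proof (cases "b i = 0")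
    case True
    \<comment> \<open>On a row with \<open>b i = 0\<close> everything vanishes except the
      nonnegative quadratic term.\<close>
    have "w i = 0"
      using iterate_bound[OF it i] True by (simp add: w_def excess_def)
    then show ?thesis using True d0[of i] L0 iterate_bound(1)[OF it i] by simp
  next
    case False
    then have bi: "0 < b i" using b_nonneg[of i] by simp
    have "p' i = p i + \<gamma> * (d i - p i)" using p'[OF i] by (simp add: d_def algebra_simps)
    then have "b i * (excess (b i) (p' i))\<^sup>2
      \<le> b i * (w i)\<^sup>2 + 2 * w i * (\<gamma> * (d i - p i)) + (\<gamma> * (d i - p i))\<^sup>2 / b i"
      using excess_sq_smooth[OF bi, of "p i" "\<gamma> * (d i - p i)"] by (simp add: w_def)
    also have "(\<gamma> * (d i - p i))\<^sup>2 / b i \<le> \<gamma>\<^sup>2 * (L * (d i + p i))"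
    proof -
      have pi: "0 \<le> p i" "p i \<le> L * b i" using iterate_bound[OF it i] by (auto simp: L_def)
      have "(d i - p i)\<^sup>2 = \<bar>d i - p i\<bar> * \<bar>d i - p i\<bar>"
        by (simp add: power2_eq_square)
      \<comment> \<open>One factor is bounded by \<open>L * b i\<close>, which cancels the division
        by \<open>b i\<close>; the other by \<open>d i + p i\<close>, which sums to at most
        \<open>2 * total\<close>. So the curvature does not depend on the dimensions.\<close>
      also have "\<dots> \<le> (L * b i) * (d i + p i)"
        using pi d0[of i] dL[OF i] by (intro mult_mono) auto
      finally have "(d i - p i)\<^sup>2 \<le> L * (d i + p i) * b i" by (simp only: mult_ac)
      then have "(d i - p i)\<^sup>2 / b i \<le> L * (d i + p i)"
        using bi by (simp only: pos_divide_le_eq)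
      then have "\<gamma>\<^sup>2 * ((d i - p i)\<^sup>2 / b i) \<le> \<gamma>\<^sup>2 * (L * (d i + p i))"
        by (rule mult_left_mono) simp
      then show ?thesis by (simp add: power_mult_distrib)
    qed
    finally have 1: "b i * (excess (b i) (p' i))\<^sup>2
      \<le> b i * (w i)\<^sup>2 + 2 * w i * (\<gamma> * (d i - p i)) + \<gamma>\<^sup>2 * (L * (d i + p i))"
      by (simp only: add_left_mono)
    have "\<gamma> * (b i * (w i)\<^sup>2 + 2 * w i * (q i - p i)) \<le> \<gamma> * (b i * (excess (b i) (q i))\<^sup>2)"
      unfolding w_def using excess_sq_convex[OF bi, of "p i" "q i"] \<gamma> by (intro mult_left_mono)
    \<comment> \<open>The direction \<open>d - p\<close> is split into \<open>q - p\<close>, treated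
      by convexity, and \<open>d - q\<close>, treated after summation by the choice of
      \<open>h\<close>.\<close>
    moreover have "b i * (w i)\<^sup>2 + 2 * w i * (\<gamma> * (d i - p i))
      = (1 - \<gamma>) * (b i * (w i)\<^sup>2) + \<gamma> * (b i * (w i)\<^sup>2 + 2 * w i * (q i - p i))
        + 2 * \<gamma> * (w i * d i - w i * q i)"
      by (simp add: algebra_simps)
    ultimately show ?thesis using 1 by linarith
  qed
  have "objective p' \<le> (\<Sum>i<m. (1 - \<gamma>) * (b i * (w i)\<^sup>2)
      + \<gamma> * (b i * (excess (b i) (q i))\<^sup>2) + 2 * \<gamma> * (w i * d i - w i * q i) + \<gamma>\<^sup>2 * (L * (d i + p i)))"
    unfolding objective_def by (intro sum_mono pointwise) simp
  also have "\<dots> = (1 - \<gamma>) * objective p + \<gamma> * objective q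
      + 2 * \<gamma> * ((\<Sum>i<m. w i * d i) - (\<Sum>i<m. w i * q i)) + \<gamma>\<^sup>2 * (L * ((\<Sum>i<m. d i) + (\<Sum>i<m. p i)))"
    unfolding objective_def sum_distrib_left sum.distrib[symmetric] sum_subtractf[symmetric]
    by (intro sum.cong) (auto simp: w_def)
  also have "2 * \<gamma> * ((\<Sum>i<m. w i * d i) - (\<Sum>i<m. w i * q i)) \<le> 0"
    using score_minimizer_le[OF h hmin z(1-3)] \<gamma>
    by (intro mult_nonneg_nonpos) (auto simp: w_def d_def q_def)
  also have "\<gamma> * objective q \<le> \<gamma> * ((2 * \<epsilon> / 15)\<^sup>2 * total)"
  proof (intro mult_left_mono \<gamma>)
    have "objective q \<le> (\<Sum>i<m. b i * (2 * \<epsilon> / 15)\<^sup>2)"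
      unfolding objective_def using z(4) eps b_nonneg
      by (intro sum_mono mult_left_mono power_mono excess_le_scaled excess_nonneg) (auto simp: q_def)
    then show "objective q \<le> (2 * \<epsilon> / 15)\<^sup>2 * total"
      unfolding total_def sum_distrib_right[symmetric] by (simp only: mult.commute)
  qed
  also have "\<gamma>\<^sup>2 * (L * ((\<Sum>i<m. d i) + (\<Sum>i<m. p i))) \<le> \<gamma>\<^sup>2 * (L * (2 * total))"
    using L0 iterate_mass[OF it] d_sum total_pos by (intro mult_left_mono) auto
  finally have "objective p' \<le> (1 - \<gamma>) * objective p + \<gamma> * ((2 * \<epsilon> / 15)\<^sup>2 * total)
      + \<gamma>\<^sup>2 * (L * (2 * total))"
    by simp
  moreover have "L * (2 * total) = 64 * real K / \<epsilon> * total" by (simp add: L_def)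
  ultimately show ?thesis by metis
qed

text \<open>The classical Frank-Wolfe induction with step size 2/(t + 2). Only entry
  \<open>h\<close> can become nonzero, so the support grows by at most one.\<close>

lemma iterate_step:
  assumes it: "iterate t x p" and h: "h < n" "eligible h"
    and hmin: "\<And>j. j < n \<Longrightarrow> eligible j \<Longrightarrow> score p h \<le> score p j"
    and \<gamma>: "\<gamma> = 2 / (real t + 2)"
    and x': "\<And>j. j < n \<Longrightarrow> x' j = (1 - \<gamma>) * x j + (if j = h then \<gamma> * total / colsum h else 0)"
    and p': "\<And>i. i < m \<Longrightarrow> p' i = (1 - \<gamma>) * p i + \<gamma> * total / colsum h * a i h"
  shows "iterate (Suc t) x' p'"
proof -
  have \<gamma>01: "0 \<le> \<gamma>" "\<gamma> \<le> 1" by (auto simp: \<gamma>)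
  have ch: "0 < colsum h" using h by (simp add: eligible_def)
  have lin: "(\<Sum>j<n. f j * x' j) = (1 - \<gamma>) * (\<Sum>j<n. f j * x j) + \<gamma> * total / colsum h * f h" for f
  proof -
    have "(\<Sum>j<n. f j * x' j) = (\<Sum>j<n. (1 - \<gamma>) * (f j * x j)
        + (if j = h then \<gamma> * total / colsum h * f j else 0))"
      by (intro sum.cong) (auto simp: x' algebra_simps)
    also have "\<dots> = (1 - \<gamma>) * (\<Sum>j<n. f j * x j) + \<gamma> * total / colsum h * f h"
      using h by (simp add: sum.distrib sum_distrib_left sum.delta)
    finally show ?thesis .
  qed
  have "p' i = (\<Sum>j<n. a i j * x' j)" if "i < m" for i
    using it that by (simp add: p' lin iterate_def)
  moreover have "0 \<le> x' j \<and> (\<not> eligible j \<longrightarrow> x' j = 0)" if "j < n" for j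
    using it that h ch \<gamma>01 total_pos by (auto simp: x' iterate_def)
  moreover have "(\<Sum>j<n. colsum j * x' j) = total"
  proof -
    have "(\<Sum>j<n. colsum j * x' j) = (1 - \<gamma>) * (\<Sum>j<n. colsum j * x j) + \<gamma> * total"
      unfolding lin using ch by simp
    \<comment> \<open>The zero start has the wrong mass, but at \<open>t = 0\<close> the step size
      is 1 and the start gets weight 0.\<close>
    moreover have "(1 - \<gamma>) * (\<Sum>j<n. colsum j * x j) = (1 - \<gamma>) * total"
      using it by (cases "t = 0") (simp_all add: iterate_def \<gamma>)
    ultimately show ?thesis by (simp only: left_diff_distrib mult_1 diff_add_cancel)
  qed
  moreover have "card {j. j < n \<and> x' j \<noteq> 0} \<le> Suc t"
  proof -
    have "card {j. j < n \<and> x' j \<noteq> 0} \<le> card (insert h {j. j < n \<and> x j \<noteq> 0})"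
      by (intro card_mono) (auto simp: x')
    also have "\<dots> \<le> Suc (card {j. j < n \<and> x j \<noteq> 0})" by (rule card_insert_le_m1) auto
    finally show ?thesis using it by (simp add: iterate_def)
  qed
  moreover have "objective p' \<le> (2 * \<epsilon> / 15)\<^sup>2 * total + 256 * real K / \<epsilon> * total / (real (Suc t) + 2)"
  proof -
    define D where "D = 64 * real K / \<epsilon> * total"
    define E where "E = (2 * \<epsilon> / 15)\<^sup>2 * total"
    have D0: "0 \<le> D" using eps total_pos by (simp add: D_def)
    have e: "256 * real K / \<epsilon> * total / r = 4 * D / r" for r by (simp add: D_def)
    have "objective p \<le> E + 4 * D / (real t + 2)"
      using it unfolding iterate_def E_def e by blast
    then have "(1 - \<gamma>) * objective p \<le> (1 - \<gamma>) * (E + 4 * D / (real t + 2))"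
      using \<gamma>01 by (intro mult_left_mono) auto
    with objective_step[OF it h(2) hmin \<gamma>01 p', folded D_def E_def]
    have "objective p' \<le> (1 - \<gamma>) * (E + 4 * D / (real t + 2)) + \<gamma> * E + \<gamma>\<^sup>2 * D" by linarith
    \<comment> \<open>The parts of \<open>E\<close> add up to \<open>E\<close>; the rest is 4D t/(t
      + 2)^2 + 4D/(t + 2)^2.\<close>
    also have "\<dots> = E + 4 * D * ((real t + 1) / (real t + 2)\<^sup>2)"
    proof -
      define r where "r = real t + 2"
      have r: "r \<noteq> 0" "real t + 1 = r - 1" by (auto simp: r_def)
      show ?thesis
        unfolding \<gamma> r(2) r_def[symmetric] using r(1) by (simp add: field_simps power2_eq_square)
    qed
    also have "\<dots> \<le> E + 4 * D * (1 / (real t + 3))"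
    proof -
      \<comment> \<open>Equivalent to (t + 1)(t + 3) <= (t + 2)^2.\<close>
      have "(real t + 1) / (real t + 2)\<^sup>2 \<le> 1 / (real t + 3)"
      proof -
        have "real t + 1 \<le> (real t + 2)\<^sup>2 / (real t + 3)"
          by (subst pos_le_divide_eq) (simp_all add: power2_eq_square algebra_simps)
        then show ?thesis by (subst pos_divide_le_eq) simp_all
      qed
      then show ?thesis using D0 by (intro add_left_mono mult_left_mono) auto
    qed
    finally show ?thesis unfolding e E_def by (simp add: add.commute)
  qed
  ultimately show ?thesis by (simp add: iterate_def)
qed

text \<open>Since \<open>p\<close> and \<open>b\<close> have equal mass, the 1-norm error is twice
  the sum of the positive parts of \<open>p i - b i\<close>, and these are at most
  \<open>b i * excess (b i) (p i)\<close>. Cauchy-Schwarz in the form of a weighted square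
  completion then bounds their sum through the objective.\<close>

lemma iterate_error:
  assumes it: "iterate t x p" and t: "2000 * real K \<le> real t * \<epsilon> ^ 3"
  shows "(\<Sum>i<m. \<bar>(\<Sum>j<n. a i j * x j) - b i\<bar>) \<le> \<epsilon> * total"
proof -
  \<comment> \<open>The zero start does not have mass \<open>total\<close>, so at least one round is
    needed.\<close>
  have "0 < t" using t K_pos by (cases t) auto
  have e3: "0 < \<epsilon> ^ 3" using eps by simp
  have "256 * real K / \<epsilon> * total / (real t + 2) \<le> 16 / 125 * \<epsilon>\<^sup>2 * total"
  proof -
    have "256 * real K \<le> 16 / 125 * (real t * \<epsilon> ^ 3)" using t by simp
    also have "\<dots> \<le> 16 / 125 * ((real t + 2) * \<epsilon> ^ 3)" using e3 by simp
    also have "\<dots> = 16 / 125 * \<epsilon>\<^sup>2 * (real t + 2) * \<epsilon>"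
      by (simp add: power2_eq_square power3_eq_cube)
    finally have "256 * real K / \<epsilon> \<le> 16 / 125 * \<epsilon>\<^sup>2 * (real t + 2)"
      using eps(1) by (simp only: pos_divide_le_eq)
    then have "256 * real K / \<epsilon> / (real t + 2) \<le> 16 / 125 * \<epsilon>\<^sup>2"
      by (subst pos_divide_le_eq) auto
    then have "256 * real K / \<epsilon> / (real t + 2) * total \<le> 16 / 125 * \<epsilon>\<^sup>2 * total"
      using total_pos by (intro mult_right_mono) auto
    then show ?thesis by (simp only: times_divide_eq_left)
  qed
  moreover have "objective p \<le> (2 * \<epsilon> / 15)\<^sup>2 * total + 256 * real K / \<epsilon> * total / (real t + 2)"
    using it by (simp add: iterate_def)
  moreover have "0 \<le> \<epsilon>\<^sup>2 * total" using total_pos by simp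
  \<comment> \<open>The numbers fit because 256/2000 = 16/125 and 4/225 + 16/125 < 1/4.\<close>
  ultimately have obj: "objective p \<le> \<epsilon>\<^sup>2 * total / 4"
    by (simp add: power_divide power_mult_distrib)
  have bw: "p i - b i \<le> b i * excess (b i) (p i)" "p i \<le> b i \<Longrightarrow> excess (b i) (p i) = 0"
    if "i < m" for i
  proof -
    show "p i \<le> b i \<Longrightarrow> excess (b i) (p i) = 0"
      using b_nonneg[of i] by (cases "b i = 0") (auto simp: excess_def)
    show "p i - b i \<le> b i * excess (b i) (p i)"
    proof (cases "b i = 0")
      case True
      then show ?thesis using iterate_bound[OF it that] by simp
    next
      case False
      then have "p i - b i = b i * (p i / b i - 1)" by (simp add: right_diff_distrib)
      also have "\<dots> \<le> b i * excess (b i) (p i)"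
        by (intro mult_left_mono b_nonneg) (simp add: excess_def)
      finally show ?thesis .
    qed
  qed
  have "(\<Sum>i<m. \<bar>p i - b i\<bar>) \<le> (\<Sum>i<m. 2 * (b i * excess (b i) (p i)) - (p i - b i))"
  proof (intro sum_mono)
    fix i assume "i \<in> {..<m}"
    then show "\<bar>p i - b i\<bar> \<le> 2 * (b i * excess (b i) (p i)) - (p i - b i)"
      using bw[of i] by (cases "p i \<le> b i") auto
  qed
  also have "\<dots> = 2 * (\<Sum>i<m. b i * excess (b i) (p i))"
    using iterate_mass[OF it] \<open>0 < t\<close>
    unfolding sum_subtractf sum_distrib_left[symmetric] total_def by simp
  also have "(\<Sum>i<m. b i * excess (b i) (p i))
      \<le> (\<Sum>i<m. (b i * (excess (b i) (p i))\<^sup>2) / \<epsilon> + \<epsilon> / 4 * b i)"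
  proof (intro sum_mono)
    fix i
    \<comment> \<open>The square of \<open>excess - \<epsilon>/2\<close> is nonnegative; divide by
      \<epsilon>.\<close>
    have "excess (b i) (p i) \<le> (excess (b i) (p i))\<^sup>2 / \<epsilon> + \<epsilon> / 4"
      using zero_le_power2[of "excess (b i) (p i) - \<epsilon> / 2"] eps
      by (simp add: field_simps power2_eq_square)
    then have "b i * excess (b i) (p i) \<le> b i * ((excess (b i) (p i))\<^sup>2 / \<epsilon> + \<epsilon> / 4)"
      by (intro mult_left_mono b_nonneg)
    then show "b i * excess (b i) (p i) \<le> (b i * (excess (b i) (p i))\<^sup>2) / \<epsilon> + \<epsilon> / 4 * b i"
      by (simp add: distrib_left mult.commute)
  qed
  also have "\<dots> = objective p / \<epsilon> + \<epsilon> / 4 * total"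
    unfolding sum.distrib objective_def total_def sum_distrib_left sum_divide_distrib ..
  also have "objective p / \<epsilon> \<le> \<epsilon> / 4 * total"
    using obj eps(1) by (subst pos_divide_le_eq) (simp_all add: power2_eq_square mult_ac)
  finally show ?thesis using it by (simp add: iterate_def)
qed

end


section \<open>Time-bounded total correctness\<close>

text \<open>An upper bound on time, rather than an exact count, lets branches of different length
  share one estimate.\<close>

definition runs :: "com \<Rightarrow> state \<Rightarrow> nat \<Rightarrow> (state \<Rightarrow> bool) \<Rightarrow> bool" where
  "runs c s T Q \<longleftrightarrow> (\<exists>t s'. exec c s t s' \<and> t \<le> T \<and> Q s')"

lemma runs_weaken:
  assumes "runs c s T Q" "T \<le> T'" "\<And>s'. Q s' \<Longrightarrow> Q' s'"
  shows "runs c s T' Q'"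
  using assms unfolding runs_def by (meson order_trans)

lemma runs_mono:
  assumes "runs c s T Q" "\<And>s'. Q s' \<Longrightarrow> Q' s'"
  shows "runs c s T Q'"
  using assms by (rule runs_weaken[OF _ order_refl])

lemma runs_Skip: "Q s \<Longrightarrow> runs Skip s 1 Q"
  unfolding runs_def using exec.Skip by blast

lemma runs_Skip_le: "Q s \<Longrightarrow> 1 \<le> T \<Longrightarrow> runs Skip s T Q"
  by (rule runs_weaken[OF runs_Skip])

lemma runs_NAssign: "Q (nupd v (nval e s) s) \<Longrightarrow> runs (NAssign v e) s 1 Q"
  unfolding runs_def using exec.NAssign by blast

lemma runs_RAssign:
  "Q (rupd v (nval i s) (nval j s) (rval e s) s) \<Longrightarrow> runs (RAssign v i j e) s 1 Q"
  unfolding runs_def using exec.RAssign by blast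

lemma runs_Seq:
  assumes "runs c1 s T1 (\<lambda>s'. runs c2 s' T2 Q)"
  shows "runs (Seq c1 c2) s (T1 + T2) Q"
  using assms unfolding runs_def by (meson exec.Seq add_mono)

lemma runs_Cond:
  assumes "bval p s \<Longrightarrow> runs c1 s T Q" "\<not> bval p s \<Longrightarrow> runs c2 s T Q"
  shows "runs (Cond p c1 c2) s (1 + T) Q"
proof (cases "bval p s")
  case True
  with assms(1) obtain t s' where "exec c1 s t s'" "t \<le> T" "Q s'" unfolding runs_def by blast
  with exec.CondTrue[OF True this(1)] show ?thesis
    unfolding runs_def by (intro exI[of _ "1 + t"] exI[of _ s']) auto
next
  case False
  with assms(2) obtain t s' where "exec c2 s t s'" "t \<le> T" "Q s'" unfolding runs_def by blast
  with exec.CondFalse[OF False this(1)] show ?thesis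
    unfolding runs_def by (intro exI[of _ "1 + t"] exI[of _ s']) auto
qed

text \<open>The invariant is indexed by the round, and the test is true exactly before round
  \<open>N\<close>; termination and time then follow by induction on the rounds left.\<close>

lemma runs_While:
  assumes "I 0 s"
    and test: "\<And>i s. i \<le> N \<Longrightarrow> I i s \<Longrightarrow> bval p s \<longleftrightarrow> i < N"
    and body: "\<And>i s. i < N \<Longrightarrow> I i s \<Longrightarrow> runs c s T (I (Suc i))"
  shows "runs (While p c) s (N * (T + 1) + 1) (I N)"
proof -
  have "runs (While p c) s ((N - i) * (T + 1) + 1) (I N)" if "i \<le> N" "I i s" for i s
    using that
  proof (induction "N - i" arbitrary: i s)
    case 0
    then have "i = N" by simp
    with 0 test[of i s] have "exec (While p c) s 1 s" by (intro exec.WhileFalse) auto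
    then show ?case using 0 \<open>i = N\<close> unfolding runs_def by fastforce
  next
    case (Suc d)
    then have i: "i < N" by simp
    with body[of i s] Suc.prems obtain t s' where 1: "exec c s t s'" "t \<le> T" "I (Suc i) s'"
      unfolding runs_def by blast
    from Suc(1)[of "Suc i" s'] Suc(2) i 1 obtain u s'' where
      2: "exec (While p c) s' u s''" "u \<le> (N - Suc i) * (T + 1) + 1" "I N s''"
      unfolding runs_def by fastforce
    have "exec (While p c) s (1 + t + u) s''"
      using 1 2 i test[of i s] Suc.prems by (intro exec.WhileTrue) auto
    moreover have "N - i = Suc (N - Suc i)" using i by simp
    then have "1 + t + u \<le> (N - i) * (T + 1) + 1" using 1 2 by simp
    ultimately show ?case using 2 unfolding runs_def by blast
  qed
  from this[of 0 s] assms(1) show ?thesis by simp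
qed

definition For :: "name \<Rightarrow> name \<Rightarrow> com \<Rightarrow> com" where
  "For v w c = Seq (NAssign v (NConst 0))
     (While (NLess (NVar v) (NVar w)) (Seq c (NAssign v (NPlus (NVar v) (NConst 1)))))"

text \<open>The invariant is stated after the counter update, so the body must restore the counter.
  Each round adds a test and an increment; the final 2 pays for initialisation and the last
  test.\<close>

lemma runs_For:
  assumes "I 0 (nupd v 0 s)"
    and bound: "\<And>i s. I i s \<Longrightarrow> fst s w = N"
    and body: "\<And>i s. i < N \<Longrightarrow> I i s \<Longrightarrow> fst s v = i \<Longrightarrow>
      runs c s T (\<lambda>s'. fst s' v = i \<and> I (Suc i) (nupd v (Suc i) s'))"
  shows "runs (For v w c) s (N * (T + 2) + 2) (I N)"
proof -
  have "runs (For v w c) s (1 + (N * (T + 1 + 1) + 1)) (\<lambda>s. I N s \<and> fst s v = N)"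
    unfolding For_def
  proof (intro runs_Seq runs_NAssign
      runs_While[where I = "\<lambda>i s. I i s \<and> fst s v = i"])
    show "I 0 (nupd v (nval (NConst 0) s) s) \<and> fst (nupd v (nval (NConst 0) s) s) v = 0"
      using assms(1) by (simp add: nupd_def)
    show "bval (NLess (NVar v) (NVar w)) s \<longleftrightarrow> i < N" if "I i s \<and> fst s v = i" for i s
      using that bound[of i s] by simp
    show "runs c s T (\<lambda>s'. runs (NAssign v (NPlus (NVar v) (NConst 1))) s' 1
        (\<lambda>s. I (Suc i) s \<and> fst s v = Suc i))"
      if "i < N" "I i s \<and> fst s v = i" for i s
      using that by (intro runs_mono[OF body[of i s]] runs_NAssign) (auto simp: nupd_def)
  qed
  then show ?thesis by (rule runs_weaken) auto
qed

text \<open>The frame condition: only registers in \<open>R\<close> and arrays in \<open>X\<close>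
  may have changed.\<close>

definition agree :: "name set \<Rightarrow> name set \<Rightarrow> state \<Rightarrow> state \<Rightarrow> bool" where
  "agree R X s s' \<longleftrightarrow> (\<forall>v. v \<notin> R \<longrightarrow> fst s' v = fst s v) \<and> (\<forall>v. v \<notin> X \<longrightarrow> snd s' v = snd s v)"

abbreviation Num :: "nat \<Rightarrow> rexp" where "Num c \<equiv> OfNat (NConst c)"
abbreviation Mat :: "name \<Rightarrow> name \<Rightarrow> name \<Rightarrow> rexp" where "Mat v i j \<equiv> Cell v (NVar i) (NVar j)"
abbreviation Scal :: "name \<Rightarrow> rexp" where "Scal v \<equiv> Cell v (NConst 0) (NConst 0)"
abbreviation Vec :: "name \<Rightarrow> name \<Rightarrow> rexp" where "Vec v i \<equiv> Cell v (NVar i) (NConst 0)"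

definition Sum :: "rexp \<Rightarrow> com" where
  "Sum e = Seq (RAssign ''s'' (NConst 0) (NConst 0) (OfNat (NConst 0)))
     (For ''i'' ''m'' (RAssign ''s'' (NConst 0) (NConst 0) (RPlus (Scal ''s'') e)))"

lemma runs_Sum:
  assumes "\<And>s'. agree {''i''} {''s''} s s' \<Longrightarrow> rval e s' = f (fst s' ''i'')"
    and "\<And>s'. agree {''i''} {''s''} s s' \<Longrightarrow> snd s' ''s'' 0 0 = (\<Sum>i<fst s ''m''. f i) \<Longrightarrow> Q s'"
  shows "runs (Sum e) s (3 * fst s ''m'' + 3) Q"
proof -
  have "runs (Sum e) s (1 + (fst s ''m'' * (1 + 2) + 2))
    (\<lambda>s'. agree {''i''} {''s''} s s' \<and> snd s' ''s'' 0 0 = (\<Sum>i<fst s ''m''. f i))"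
    unfolding Sum_def
    by (intro runs_Seq runs_RAssign
        runs_For[where I = "\<lambda>i s'. agree {''i''} {''s''} s s' \<and> snd s' ''s'' 0 0 = (\<Sum>i<i. f i)"])
      (use assms(1) in \<open>auto simp: agree_def nupd_def rupd_def\<close>)
  then show ?thesis by (rule runs_weaken) (auto intro: assms(2))
qed

section \<open>The program and its verification\<close>

text \<open>Ineligible columns are marked by \<open>c\<^sub>j = 0\<close>.\<close>

definition columns_prog :: com where
  "columns_prog = For ''j'' ''n''
     (Seq (Sum (Mat ''A'' ''i'' ''j''))
     (Seq (RAssign ''c'' (NVar ''j'') (NConst 0) (Scal ''s''))
       (For ''i'' ''m''
         (Cond (RLess (RTimes (RTimes (RTimes (Num 32) (OfNat (NVar ''k''))) (Vec ''c'' ''j'')) (Vec ''b'' ''i''))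
                      (RTimes (RTimes (Mat ''A'' ''i'' ''j'') (Scal ''S'')) (Scal ''eps'')))
           (RAssign ''c'' (NVar ''j'') (NConst 0) (Num 0))
           Skip))))"

text \<open>\<open>h = n\<close> encodes that no eligible column has been found yet.\<close>

definition select_prog :: com where
  "select_prog = Seq (NAssign ''h'' (NVar ''n''))
     (For ''j'' ''n''
       (Cond (RLess (Num 0) (Vec ''c'' ''j''))
         (Seq (Sum (RTimes (Vec ''w'' ''i'') (Mat ''A'' ''i'' ''j'')))
           (Cond (BAnd (NLess (NVar ''h'') (NVar ''n''))
                       (BNot (RLess (RDiv (Scal ''s'') (Vec ''c'' ''j'')) (Scal ''v''))))
             Skip
             (Seq (RAssign ''v'' (NConst 0) (NConst 0) (RDiv (Scal ''s'') (Vec ''c'' ''j'')))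
                  (NAssign ''h'' (NVar ''j'')))))
         Skip))"

abbreviation gain :: rexp where
  "gain \<equiv> RDiv (RTimes (Scal ''g'') (Scal ''S'')) (Vec ''c'' ''h'')"

definition move_x_prog :: com where
  "move_x_prog = Seq
     (For ''j'' ''n''
       (RAssign ''x'' (NVar ''j'') (NConst 0) (RTimes (RMinus (Num 1) (Scal ''g'')) (Vec ''x'' ''j''))))
     (RAssign ''x'' (NVar ''h'') (NConst 0) (RPlus (Vec ''x'' ''h'') gain))"

text \<open>Updating \<open>p = A x\<close> incrementally avoids a matrix product per round. Machine
  division by zero agrees with the default in \<open>excess\<close>, so \<open>w\<close> is right on
  zero rows too.\<close>

definition move_p_prog :: com where
  "move_p_prog = For ''i'' ''m''
     (Seq (RAssign ''p'' (NVar ''i'') (NConst 0)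
            (RPlus (RTimes (RMinus (Num 1) (Scal ''g'')) (Vec ''p'' ''i'')) (RTimes gain (Mat ''A'' ''i'' ''h''))))
       (Cond (RLess (Num 0) (RMinus (RDiv (Vec ''p'' ''i'') (Vec ''b'' ''i'')) (Num 1)))
         (RAssign ''w'' (NVar ''i'') (NConst 0) (RMinus (RDiv (Vec ''p'' ''i'') (Vec ''b'' ''i'')) (Num 1)))
         (RAssign ''w'' (NVar ''i'') (NConst 0) (Num 0))))"

definition step_prog :: com where
  "step_prog = Seq select_prog
     (Seq (RAssign ''g'' (NConst 0) (NConst 0) (RDiv (Num 2) (OfNat (NPlus (NVar ''t'') (NConst 2)))))
     (Seq move_x_prog
     (Seq move_p_prog
       (NAssign ''t'' (NPlus (NVar ''t'') (NConst 1))))))"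

definition loop_prog :: com where
  "loop_prog = While
     (RLess (RTimes (RTimes (RTimes (OfNat (NVar ''t'')) (Scal ''eps'')) (Scal ''eps'')) (Scal ''eps''))
            (RTimes (Num 2000) (OfNat (NVar ''k''))))
     step_prog"

text \<open>The time bound does not mention \<open>k\<close>, so \<open>k\<close> is first capped at
  \<open>n\<close>; a vector of length \<open>n\<close> cannot have more nonzero entries.\<close>

definition solver :: com where
  "solver = Seq (Cond (NLess (NVar ''n'') (NVar ''k'')) (NAssign ''k'' (NVar ''n'')) Skip)
     (Seq (Sum (Vec ''b'' ''i''))
     (Seq (RAssign ''S'' (NConst 0) (NConst 0) (Scal ''s''))
       (Cond (BAnd (RLess (Scal ''eps'') (Num 1)) (RLess (Num 0) (Scal ''S'')))
         (Seq columns_prog loop_prog)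
         Skip)))"

section \<open>Correctness and step counts of the program parts\<close>

context nonneg_system
begin

definition loaded :: "state \<Rightarrow> bool" where
  "loaded s \<longleftrightarrow> fst s ''m'' = m \<and> fst s ''n'' = n \<and> fst s ''k'' = K \<and>
     (\<forall>i j. snd s ''A'' i j = a i j) \<and> (\<forall>i. snd s ''b'' i 0 = b i) \<and> snd s ''eps'' 0 0 = \<epsilon> \<and>
     snd s ''S'' 0 0 = total"

definition prepared :: "state \<Rightarrow> bool" where
  "prepared s \<longleftrightarrow> loaded s \<and> (\<forall>j<n. snd s ''c'' j 0 = (if eligible j then colsum j else 0))"

definition running :: "nat \<Rightarrow> state \<Rightarrow> bool" where
  "running t s \<longleftrightarrow> prepared s \<and> fst s ''t'' = t \<and>
     iterate t (\<lambda>j. snd s ''x'' j 0) (\<lambda>i. snd s ''p'' i 0) \<and>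
     (\<forall>i<m. snd s ''w'' i 0 = excess (b i) (snd s ''p'' i 0))"

text \<open>The value of \<open>c\<^sub>j\<close> after rows below \<open>i\<close> have been tested; a zeroed entry stays zero.\<close>

definition screened :: "nat \<Rightarrow> nat \<Rightarrow> real" where
  "screened i j = (if \<forall>l<i. a l j * total * \<epsilon> \<le> 32 * real K * colsum j * b l then colsum j else 0)"

lemma screened_Suc:
  "screened (Suc i) j =
    (if a i j * total * \<epsilon> \<le> 32 * real K * colsum j * b i then screened i j else 0)"
  by (auto simp: screened_def less_Suc_eq)

lemma runs_columns:
  assumes "loaded s" "\<And>j. 0 \<le> colsum j"
    and Q: "\<And>s'. agree {''i'', ''j''} {''s'', ''c''} s s' \<Longrightarrow> prepared s' \<Longrightarrow> Q s'"
  shows "runs columns_prog s (n * (7 * m + 8) + 2) Q"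
proof -
  define I where "I j s' \<longleftrightarrow> agree {''i'', ''j''} {''s'', ''c''} s s' \<and> (\<forall>l<j. snd s' ''c'' l 0 = screened m l)"
    for j s'
  define I' where "I' j i s' \<longleftrightarrow> agree {''i'', ''j''} {''s'', ''c''} s s' \<and> fst s' ''j'' = j \<and>
      (\<forall>l<j. snd s' ''c'' l 0 = screened m l) \<and> snd s' ''c'' j 0 = screened i j" for j i s'
  have inp: "fst s ''m'' = m" "fst s ''n'' = n" "fst s ''k'' = K"
     "snd s ''A'' i j = a i j" "snd s ''b'' i 0 = b i" "snd s ''eps'' 0 0 = \<epsilon>"
     "snd s ''S'' 0 0 = total" for i j using assms(1) by (auto simp: loaded_def)
  have "runs columns_prog s (n * ((3 * m + 3 + (1 + (m * ((1 + 1) + 2) + 2))) + 2) + 2) (I n)"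
    unfolding columns_prog_def
  proof (rule runs_For[where I = I])
    show "I 0 (nupd ''j'' 0 s)" by (simp add: I_def agree_def nupd_def)
    show "fst s' ''n'' = n" if "I i s'" for i s' using that inp by (simp add: I_def agree_def)
    fix j s1 assume j: "j < n" and I: "I j s1" "fst s1 ''j'' = j"
    have m1: "fst s1 ''m'' = m" using I inp by (simp add: I_def agree_def)
    show "runs (Seq (Sum (Mat ''A'' ''i'' ''j''))
       (Seq (RAssign ''c'' (NVar ''j'') (NConst 0) (Scal ''s''))
       (For ''i'' ''m''
         (Cond (RLess (RTimes (RTimes (RTimes (Num 32) (OfNat (NVar ''k''))) (Vec ''c'' ''j'')) (Vec ''b'' ''i''))
                      (RTimes (RTimes (Mat ''A'' ''i'' ''j'') (Scal ''S'')) (Scal ''eps'')))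
           (RAssign ''c'' (NVar ''j'') (NConst 0) (Num 0))
           Skip)))) s1 (3 * m + 3 + (1 + (m * ((1 + 1) + 2) + 2)))
       (\<lambda>s'. fst s' ''j'' = j \<and> I (Suc j) (nupd ''j'' (Suc j) s'))"
    proof (rule runs_Seq, rule runs_Sum[where f = "\<lambda>i. a i j" and s = s1, unfolded m1],
        goal_cases)
      case (1 s2)
      then show ?case using I inp by (simp add: I_def agree_def)
    next
      case (2 s2)
      then have s2: "snd s2 ''s'' 0 0 = colsum j" "agree {''i'', ''j''} {''s'', ''c''} s s2"
        "fst s2 ''j'' = j" "\<forall>l<j. snd s2 ''c'' l 0 = screened m l"
        using I by (auto simp: I_def agree_def colsum_def)
      show ?case
      proof (rule runs_Seq, rule runs_RAssign, rule runs_mono, rule runs_For[where I = "I' j"],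
          goal_cases)
        case 1
        show ?case using s2 by (simp add: I'_def agree_def nupd_def rupd_def screened_def)
      next
        case (2 i s3)
        then show ?case using inp by (simp add: I'_def agree_def)
      next
        case (3 i s3)
        then have A: "agree {''i'', ''j''} {''s'', ''c''} s s3" "fst s3 ''j'' = j" "fst s3 ''i'' = i"
            "\<forall>l<j. snd s3 ''c'' l 0 = screened m l" "snd s3 ''c'' j 0 = screened i j"
          by (auto simp: I'_def)
        \<comment> \<open>The test reads the current \<open>c\<close>, not the column sum. Once that
          entry is zero, either branch leaves it zero.\<close>
        have z: "screened i j = colsum j \<or> screened i j = 0" by (simp add: screened_def)
        have e: "snd s3 ''b'' i 0 = b i" "snd s3 ''A'' i j = a i j" "snd s3 ''S'' 0 0 = total"
          "snd s3 ''eps'' 0 0 = \<epsilon>" "fst s3 ''k'' = K" using A inp by (auto simp: agree_def)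
        show ?case
        proof (intro runs_Cond runs_RAssign runs_Skip_le, goal_cases)
          case 1
          then have "screened (Suc i) j = 0"
            using z by (auto simp: screened_Suc A e)
          then show ?case using A by (simp add: I'_def agree_def nupd_def rupd_def)
        next
          case 2
          then have "screened (Suc i) j = screened i j"
            using z by (auto simp: screened_Suc A e)
          then show ?case using A by (simp add: I'_def agree_def nupd_def)
        qed simp
      next
        case (4 s3)
        then show ?case by (auto simp: I_def I'_def agree_def nupd_def less_Suc_eq)
      qed
    qed
  qed
  then show ?thesis
  proof (rule runs_weaken)
    fix s' assume "I n s'"
    then have A: "agree {''i'', ''j''} {''s'', ''c''} s s'" "\<forall>l<n. snd s' ''c'' l 0 = screened m l"
      by (auto simp: I_def)
    \<comment> \<open>A column of sum zero is not eligible, but its screened value is 0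
      anyway.\<close>
    have "screened m j = (if eligible j then colsum j else 0)" for j
      using assms(2)[of j] by (auto simp: screened_def eligible_def)
    then have "prepared s'" using A inp by (simp add: prepared_def loaded_def agree_def)
    with A show "Q s'" by (intro Q)
  qed simp
qed

lemma runs_select:
  assumes s: "running t s" and ex: "\<exists>j<n. eligible j"
    and Q: "\<And>s' h. agree {''i'', ''j'', ''h''} {''s'', ''v''} s s' \<Longrightarrow> fst s' ''h'' = h \<Longrightarrow> h < n \<Longrightarrow>
      eligible h \<Longrightarrow> (\<And>j. j < n \<Longrightarrow> eligible j \<Longrightarrow> score (\<lambda>i. snd s ''p'' i 0) h \<le> score (\<lambda>i. snd s ''p'' i 0) j)
      \<Longrightarrow> Q s'"
  shows "runs select_prog s (n * (3 * m + 9) + 3) Q"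
proof -
  let ?score = "score (\<lambda>i. snd s ''p'' i 0)"
  \<comment> \<open>Either \<open>h\<close> is still the sentinel \<open>n\<close>, or it is a best
    eligible column so far and \<open>v\<close> caches its score. Existence of an eligible column
    rules out the sentinel at the end.\<close>
  define I where "I j s' \<longleftrightarrow> agree {''i'', ''j'', ''h''} {''s'', ''v''} s s' \<and>
    ((\<forall>l<j. \<not> eligible l) \<and> fst s' ''h'' = n \<or>
     fst s' ''h'' < n \<and> eligible (fst s' ''h'') \<and> snd s' ''v'' 0 0 = ?score (fst s' ''h'') \<and>
     (\<forall>l<j. eligible l \<longrightarrow> ?score (fst s' ''h'') \<le> ?score l))" for j s'
  have inp: "fst s ''m'' = m" "fst s ''n'' = n" "snd s ''A'' i j = a i j"
     "j < n \<Longrightarrow> snd s ''c'' j 0 = (if eligible j then colsum j else 0)"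
     "i < m \<Longrightarrow> snd s ''w'' i 0 = excess (b i) (snd s ''p'' i 0)" for i j
    using s by (auto simp: running_def prepared_def loaded_def)
  have "runs select_prog s (1 + (n * ((1 + (3 * m + 3 + (1 + (1 + 1)))) + 2) + 2)) (I n)"
    unfolding select_prog_def
  proof (rule runs_Seq, rule runs_NAssign, rule runs_For[where I = I], goal_cases)
    case 1
    show ?case using inp by (simp add: I_def agree_def nupd_def)
  next
    case (2 j s1)
    then show ?case using inp by (simp add: I_def agree_def)
  next
    case step: (3 j s1)
    then have A: "agree {''i'', ''j'', ''h''} {''s'', ''v''} s s1" by (simp add: I_def)
    have m1: "fst s1 ''m'' = m" "snd s1 ''c'' j 0 = (if eligible j then colsum j else 0)"
      using A inp(1,4) step by (auto simp: agree_def)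
    show ?case
    proof (rule runs_Cond, rule runs_Seq,
        rule runs_Sum[where f = "\<lambda>i. snd s ''w'' i 0 * a i j" and s = s1, unfolded m1], goal_cases)
      case (1 s2)
      then show ?case using A step inp(3) by (simp add: agree_def)
    next
      case (2 s2)
      have el: "eligible j" using 2(1) m1 step(3) by (simp split: if_splits)
      have B: "agree {''i'', ''j'', ''h''} {''s'', ''v''} s s2" "fst s2 ''j'' = j"
        "fst s2 ''h'' = fst s1 ''h''" "snd s2 ''v'' = snd s1 ''v''"
        "fst s2 ''n'' = n" "snd s2 ''c'' j 0 = colsum j"
        using 2(2) A step m1 el inp(2) by (auto simp: agree_def)
      have sc: "snd s2 ''s'' 0 0 / colsum j = ?score j"
        unfolding 2(3) score_def using inp(5) by simp
      show ?case
      proof (intro runs_Cond runs_Seq runs_RAssign runs_NAssign runs_Skip_le, goal_cases)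
        case 1
        then show ?case using step(2) B el sc
          by (auto simp: I_def agree_def nupd_def less_Suc_eq)
      next
        case 3
        have "?score j \<le> ?score l" if "l < j" "eligible l" for l
          using 3 \<open>I j s1\<close> B sc that by (auto simp: I_def)
        then show ?case using B el sc \<open>j < n\<close>
          by (auto simp: I_def agree_def nupd_def rupd_def less_Suc_eq)
      qed simp
    next
      case 3
      then have "snd s1 ''c'' j 0 \<le> 0" using step(3) by simp
      moreover have "0 < colsum j" if "eligible j" using that by (simp add: eligible_def)
      ultimately have "\<not> eligible j" using m1(2) by auto
      then show ?case using step
        by (intro runs_Skip_le) (auto simp: I_def agree_def nupd_def less_Suc_eq)
    qed
  qed
  then show ?thesis
  proof (rule runs_weaken)
    fix s' assume "I n s'"
    with ex show "Q s'" by (intro Q) (auto simp: I_def)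
  qed simp
qed

lemma runs_move_x:
  assumes Q: "\<And>s'. agree {''j''} {''x''} s s' \<Longrightarrow>
      (\<And>j. snd s' ''x'' j 0 = (if j < fst s ''n'' then (1 - snd s ''g'' 0 0) * snd s ''x'' j 0 else snd s ''x'' j 0)
        + (if j = fst s ''h'' then snd s ''g'' 0 0 * snd s ''S'' 0 0 / snd s ''c'' (fst s ''h'') 0 else 0))
      \<Longrightarrow> Q s'"
  shows "runs move_x_prog s (3 * fst s ''n'' + 3) Q"
proof -
  define I where "I j s' \<longleftrightarrow> agree {''j''} {''x''} s s' \<and>
    (\<forall>l. snd s' ''x'' l 0 = (if l < j then (1 - snd s ''g'' 0 0) * snd s ''x'' l 0 else snd s ''x'' l 0))"
    for j s'
  have "runs move_x_prog s ((fst s ''n'' * (1 + 2) + 2) + 1) Q"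
    unfolding move_x_prog_def
  proof (rule runs_Seq, rule runs_mono, rule runs_For[where I = I], goal_cases)
    case 1
    show ?case by (simp add: I_def agree_def nupd_def)
  next
    case (2 j s1)
    then show ?case by (simp add: I_def agree_def)
  next
    case (3 j s1)
    then show ?case
      by (intro runs_RAssign) (auto simp: I_def agree_def nupd_def rupd_def less_Suc_eq)
  next
    case (4 s1)
    then show ?case
      by (intro runs_RAssign Q) (auto simp: I_def agree_def rupd_def)
  qed
  then show ?thesis by (rule runs_weaken) auto
qed

lemma runs_move_p:
  assumes "loaded s"
    and Q: "\<And>s'. agree {''i''} {''p'', ''w''} s s' \<Longrightarrow>
      (\<And>i. i < m \<Longrightarrow> snd s' ''p'' i 0 = (1 - snd s ''g'' 0 0) * snd s ''p'' i 0
        + snd s ''g'' 0 0 * total / snd s ''c'' (fst s ''h'') 0 * a i (fst s ''h'')) \<Longrightarrow>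
      (\<And>i. i < m \<Longrightarrow> snd s' ''w'' i 0 = excess (b i) (snd s' ''p'' i 0)) \<Longrightarrow> Q s'"
  shows "runs move_p_prog s (5 * m + 2) Q"
proof -
  define new where "new i = (1 - snd s ''g'' 0 0) * snd s ''p'' i 0
        + snd s ''g'' 0 0 * total / snd s ''c'' (fst s ''h'') 0 * a i (fst s ''h'')" for i
  define I where "I i s' \<longleftrightarrow> agree {''i''} {''p'', ''w''} s s' \<and>
    (\<forall>l. snd s' ''p'' l 0 = (if l < i then new l else snd s ''p'' l 0)) \<and>
    (\<forall>l<i. snd s' ''w'' l 0 = excess (b l) (new l))" for i s'
  have inp: "fst s ''m'' = m" "snd s ''A'' i j = a i j" "snd s ''b'' i 0 = b i"
     "snd s ''S'' 0 0 = total" for i j using assms(1) by (auto simp: loaded_def)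
  have "runs move_p_prog s (m * ((1 + (1 + 1)) + 2) + 2) (I m)"
    unfolding move_p_prog_def
  proof (rule runs_For[where I = I], goal_cases)
    case 1
    show ?case by (simp add: I_def agree_def nupd_def)
  next
    case (2 i s1)
    then show ?case using inp by (simp add: I_def agree_def)
  next
    case (3 i s1)
    then have A: "agree {''i''} {''p'', ''w''} s s1" "snd s1 ''p'' i 0 = snd s ''p'' i 0"
      by (auto simp: I_def)
    have e: "fst s1 ''h'' = fst s ''h''" "snd s1 ''g'' = snd s ''g''" "snd s1 ''c'' = snd s ''c''"
        "snd s1 ''S'' 0 0 = total" "snd s1 ''A'' i j = a i j" "snd s1 ''b'' i 0 = b i" for j
      using A(1) inp by (auto simp: agree_def)
    define s2 where "s2 = rupd ''p'' i 0 (new i) s1"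
    have s2: "agree {''i''} {''p'', ''w''} s s2" "fst s2 ''i'' = i" "snd s2 ''p'' i 0 = new i"
      "\<forall>l. snd s2 ''p'' l 0 = (if l < Suc i then new l else snd s ''p'' l 0)"
      "\<forall>l<i. snd s2 ''w'' l 0 = excess (b l) (new l)" "snd s2 ''b'' i 0 = b i"
      using 3 e by (auto simp: s2_def I_def agree_def rupd_def less_Suc_eq)
    show ?case
    proof (rule runs_Seq, rule runs_RAssign, goal_cases)
      case 1
      have "rupd ''p'' (nval (NVar ''i'') s1) (nval (NConst 0) s1) (rval (RPlus (RTimes (RMinus (Num 1)
          (Scal ''g'')) (Vec ''p'' ''i'')) (RTimes gain (Mat ''A'' ''i'' ''h''))) s1) s1 = s2"
        using 3 A e by (simp add: s2_def new_def)
      moreover have "runs (Cond (RLess (Num 0) (RMinus (RDiv (Vec ''p'' ''i'') (Vec ''b'' ''i'')) (Num 1)))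
         (RAssign ''w'' (NVar ''i'') (NConst 0) (RMinus (RDiv (Vec ''p'' ''i'') (Vec ''b'' ''i'')) (Num 1)))
         (RAssign ''w'' (NVar ''i'') (NConst 0) (Num 0))) s2 (1 + 1)
         (\<lambda>s'. fst s' ''i'' = i \<and> I (Suc i) (nupd ''i'' (Suc i) s'))"
        using s2 by (intro runs_Cond runs_RAssign)
          (auto simp: I_def agree_def nupd_def rupd_def less_Suc_eq excess_def)
      ultimately show ?case by simp
    qed
  qed
  then show ?thesis
  proof (rule runs_weaken)
    fix s' assume "I m s'"
    then show "Q s'" by (intro Q) (auto simp: I_def new_def)
  qed simp
qed

text \<open>The two outcomes of the guard are left as premises, so one lemma serves both the
  iteration and the case where the output stays zero.\<close>

lemma runs_solver:
  assumes s: "fst s ''m'' = m" "fst s ''n'' = n" "min (fst s ''k'') n = K"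
     "\<And>i j. snd s ''A'' i j = a i j" "\<And>i. snd s ''b'' i 0 = b i" "snd s ''eps'' 0 0 = \<epsilon>"
    and main: "\<And>s'. agree {''i'', ''k''} {''s'', ''S''} s s' \<Longrightarrow> loaded s' \<Longrightarrow> \<epsilon> < 1 \<Longrightarrow> 0 < total \<Longrightarrow>
      runs (Seq columns_prog loop_prog) s' T Q"
    and trivial: "\<And>s'. agree {''i'', ''k''} {''s'', ''S''} s s' \<Longrightarrow> \<not> (\<epsilon> < 1 \<and> 0 < total) \<Longrightarrow> Q s'"
    and T: "1 \<le> T"
  shows "runs solver s (3 * m + 7 + T) Q"
proof -
  have "runs solver s ((1 + 1) + ((3 * m + 3) + (1 + (1 + T)))) Q"
    unfolding solver_def
  proof (rule runs_Seq)
    show "runs (Cond (NLess (NVar ''n'') (NVar ''k'')) (NAssign ''k'' (NVar ''n'')) Skip) s (1 + 1)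
       (\<lambda>s'. runs (Seq (Sum (Vec ''b'' ''i''))
     (Seq (RAssign ''S'' (NConst 0) (NConst 0) (Scal ''s''))
       (Cond (BAnd (RLess (Scal ''eps'') (Num 1)) (RLess (Num 0) (Scal ''S'')))
         (Seq columns_prog loop_prog)
         Skip))) s' ((3 * m + 3) + (1 + (1 + T))) Q)"
      (is "runs _ _ _ ?Q")
    proof -
      have rest: "?Q s1" if A: "agree {''k''} {} s s1" "fst s1 ''k'' = K" for s1
      proof -
        have m1: "fst s1 ''m'' = m" using A s by (simp add: agree_def)
        show ?thesis
        proof (rule runs_Seq, rule runs_Sum[where f = b and s = s1, unfolded m1], goal_cases)
          case (1 s2)
          then show ?case using A s by (simp add: agree_def)
        next
          case (2 s2)
          define s3 where "s3 = rupd ''S'' 0 0 total s2"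
          have B: "agree {''i'', ''k''} {''s'', ''S''} s s3"
            using A 2(1) by (auto simp: s3_def agree_def rupd_def)
          moreover have "fst s3 ''k'' = K" "snd s3 ''S'' 0 0 = total"
            using A(2) 2(1) by (auto simp: s3_def agree_def rupd_def)
          ultimately have L: "loaded s3" using s by (simp add: loaded_def agree_def)
          have "runs (Cond (BAnd (RLess (Scal ''eps'') (Num 1)) (RLess (Num 0) (Scal ''S'')))
             (Seq columns_prog loop_prog) Skip) s3 (1 + T) Q"
            using L T by (intro runs_Cond main[OF B L] runs_Skip_le trivial[OF B]) (auto simp: loaded_def)
          moreover have "rupd ''S'' (nval (NConst 0) s2) (nval (NConst 0) s2) (rval (Scal ''s'') s2) s2 = s3"
            using 2(2) by (simp add: s3_def total_def)
          ultimately show ?case by (intro runs_Seq runs_RAssign) (simp only:)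
        qed
      qed
      show ?thesis
        by (rule runs_Cond; (rule runs_NAssign | rule runs_Skip); rule rest)
          (use s in \<open>auto simp: agree_def nupd_def\<close>)
    qed
  qed
  then show ?thesis by (rule runs_weaken) auto
qed

end

section \<open>One round, the number of rounds, and the loop\<close>

context sparse_system
begin

lemma runs_step:
  assumes s: "running t s"
  shows "runs step_prog s (3 * m * n + 12 * n + 5 * m + 10) (running (Suc t))"
proof -
  have "runs step_prog s ((n * (3 * m + 9) + 3) + (1 + ((3 * n + 3) + ((5 * m + 2) + 1)))) (running (Suc t))"
    unfolding step_prog_def
  proof (rule runs_Seq, rule runs_select[OF s ex_eligible], rule runs_Seq, rule runs_RAssign, goal_cases)
    case (1 s1 h)
    define \<gamma> where "\<gamma> = 2 / (real t + 2)"
    define s2 where "s2 = rupd ''g'' 0 0 \<gamma> s1"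
    have s0: "loaded s" "fst s ''n'' = n" "fst s ''t'' = t" "snd s ''S'' 0 0 = total"
        "\<forall>j<n. snd s ''c'' j 0 = (if eligible j then colsum j else 0)"
        "iterate t (\<lambda>j. snd s ''x'' j 0) (\<lambda>i. snd s ''p'' i 0)"
      using s by (auto simp: running_def prepared_def loaded_def)
    have A: "agree {''i'', ''j'', ''h''} {''s'', ''v'', ''g''} s s2" "fst s2 ''h'' = h" "snd s2 ''g'' 0 0 = \<gamma>"
      using 1 by (auto simp: s2_def agree_def rupd_def)
    have e: "fst s2 ''n'' = n" "fst s2 ''t'' = t" "snd s2 ''S'' 0 0 = total" "snd s2 ''c'' h 0 = colsum h"
        "snd s2 ''x'' = snd s ''x''" "snd s2 ''p'' = snd s ''p''"
      using A(1) s0 1(3,4) by (auto simp: agree_def)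
    have "runs (Seq move_x_prog (Seq move_p_prog (NAssign ''t'' (NPlus (NVar ''t'') (NConst 1))))) s2
        ((3 * fst s2 ''n'' + 3) + ((5 * m + 2) + 1)) (running (Suc t))"
    proof (rule runs_Seq, rule runs_move_x, rule runs_Seq, rule runs_move_p, goal_cases)
      case (1 s3)
      then show ?case using A(1) s0(1) by (simp add: loaded_def agree_def)
    next
      case (2 s3 s4)
      have B: "agree {''i'', ''j'', ''h''} {''s'', ''v'', ''g'', ''x'', ''p'', ''w''} s s4"
        using A(1) 2(1,3) by (auto simp: agree_def)
      have x4: "snd s4 ''x'' j 0 = (1 - \<gamma>) * snd s ''x'' j 0 + (if j = h then \<gamma> * total / colsum h else 0)"
        if "j < n" for j
      proof -
        have "snd s4 ''x'' = snd s3 ''x''" using 2(3) by (simp add: agree_def)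
        then show ?thesis using 2(2)[of j] that A e by simp
      qed
      have p4: "snd s4 ''p'' i 0 = (1 - \<gamma>) * snd s ''p'' i 0 + \<gamma> * total / colsum h * a i h"
        if "i < m" for i
      proof -
        have "snd s3 ''g'' = snd s2 ''g''" "snd s3 ''p'' = snd s2 ''p''" "snd s3 ''c'' = snd s2 ''c''"
          "fst s3 ''h'' = fst s2 ''h''" using 2(1) by (simp_all add: agree_def)
        then show ?thesis using 2(4)[OF that] A e by simp
      qed
      have "iterate (Suc t) (\<lambda>j. snd s4 ''x'' j 0) (\<lambda>i. snd s4 ''p'' i 0)"
        using iterate_step[OF s0(6) 1(3,4,5) \<gamma>_def x4 p4] .
      moreover have "loaded s4" "fst s4 ''t'' = t"
        using B s0(1,3) by (auto simp: loaded_def agree_def)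
      moreover have "\<forall>j<n. snd s4 ''c'' j 0 = (if eligible j then colsum j else 0)"
        using B s0(5) by (simp add: agree_def)
      ultimately show ?case using 2(5)
        by (intro runs_NAssign) (simp add: running_def prepared_def loaded_def nupd_def)
    qed
    moreover have "rupd ''g'' (nval (NConst 0) s1) (nval (NConst 0) s1)
        (rval (RDiv (Num 2) (OfNat (NPlus (NVar ''t'') (NConst 2)))) s1) s1 = s2"
      using 1(1) s0(3) by (simp add: s2_def \<gamma>_def agree_def add.commute)
    ultimately show ?case using e(1) by simp
  qed
  then show ?thesis by (rule runs_weaken) (auto simp: algebra_simps)
qed

definition rounds :: nat where
  "rounds = nat \<lceil>2000 * real K / \<epsilon> ^ 3\<rceil>"

lemma less_rounds_iff: "t < rounds \<longleftrightarrow> real t * \<epsilon> ^ 3 < 2000 * real K"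
proof -
  have "t < rounds \<longleftrightarrow> int t < \<lceil>2000 * real K / \<epsilon> ^ 3\<rceil>" by (auto simp: rounds_def)
  also have "\<dots> \<longleftrightarrow> real t < 2000 * real K / \<epsilon> ^ 3" by (simp add: less_ceiling_iff)
  also have "\<dots> \<longleftrightarrow> real t * \<epsilon> ^ 3 < 2000 * real K" using eps by (simp add: pos_less_divide_eq)
  finally show ?thesis .
qed

text \<open>Rounding up costs at most 1, which is at most K/\<epsilon>^3 because
  \<open>K >= 1\<close> and \<epsilon> < 1.\<close>

lemma rounds_le: "real rounds \<le> 2001 * real K / \<epsilon> ^ 3"
proof -
  have "0 \<le> 2000 * real K / \<epsilon> ^ 3" using eps by simp
  then have "real rounds \<le> 2000 * real K / \<epsilon> ^ 3 + 1" unfolding rounds_def by linarith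
  also have "1 \<le> real K / \<epsilon> ^ 3"
  proof -
    have "\<epsilon> ^ 3 \<le> 1" using eps by (simp add: power_le_one)
    also have "1 \<le> real K" using K_pos by simp
    finally show ?thesis using eps by (simp add: pos_le_divide_eq)
  qed
  finally show ?thesis by (simp add: add_divide_distrib[symmetric])
qed

lemma runs_loop:
  assumes "running 0 s"
  shows "runs loop_prog s (rounds * (3 * m * n + 12 * n + 5 * m + 11) + 1) (running rounds)"
proof -
  have "runs loop_prog s (rounds * ((3 * m * n + 12 * n + 5 * m + 10) + 1) + 1) (running rounds)"
    unfolding loop_prog_def
  proof (rule runs_While)
    fix i s assume "running i s"
    then show "bval (RLess (RTimes (RTimes (RTimes (OfNat (NVar ''t'')) (Scal ''eps'')) (Scal ''eps'')) (Scal ''eps''))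
            (RTimes (Num 2000) (OfNat (NVar ''k'')))) s \<longleftrightarrow> i < rounds"
      by (simp add: less_rounds_iff running_def prepared_def loaded_def power3_eq_cube mult.assoc)
  qed (use assms runs_step in auto)
  then show ?thesis by (rule runs_weaken) auto
qed

lemma runs_columns_loop:
  assumes s: "loaded s" "fst s ''t'' = 0" "snd s ''x'' = (\<lambda>_ _. 0)" "snd s ''p'' = (\<lambda>_ _. 0)"
    "snd s ''w'' = (\<lambda>_ _. 0)"
  shows "runs (Seq columns_prog loop_prog) s
    (n * (7 * m + 8) + 2 + (rounds * (3 * m * n + 12 * n + 5 * m + 11) + 1)) (running rounds)"
proof (intro runs_Seq runs_columns[OF s(1)] colsum_nonneg runs_loop)
  fix s' assume "agree {''i'', ''j''} {''s'', ''c''} s s'" "prepared s'"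
  then show "running 0 s'"
    using s iterate_init by (simp add: running_def agree_def excess_def)
qed

end

section \<open>Transfer to matrices and the polynomial time bound\<close>

lemma mult_mat_vec_nth:
  assumes "A \<in> carrier_mat m n" "dim_vec x = n" "i < m"
  shows "(A *\<^sub>v x) $ i = (\<Sum>j<n. A $$ (i, j) * x $ j)"
  using assms by (simp add: scalar_prod_def atLeast0LessThan)

text \<open>With \<open>Z\<close> dominating 1, \<open>m\<close>, \<open>n\<close> and
  \<open>1 / \<epsilon>\<close>, there are at most 2001 Z^4 rounds of cost at most 31 Z^2 each, and
  the remaining work is at most 28 Z^6.\<close>

lemma time_bound:
  fixes m n K r :: nat and \<epsilon> :: real
  assumes \<epsilon>: "0 < \<epsilon>" and K: "K \<le> n" and r: "real r \<le> 2001 * real K / \<epsilon> ^ 3"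
  shows "real (3 * m + 7 + (n * (7 * m + 8) + 2 + (r * (3 * m * n + 12 * n + 5 * m + 11) + 1)))
    \<le> 70000 * (1 + (real m + real n + 1 / \<epsilon>)) ^ 6"
proof -
  define Z where "Z = 1 + (real m + real n + 1 / \<epsilon>)"
  have Z: "1 \<le> Z" "real m \<le> Z" "real n \<le> Z" "1 / \<epsilon> \<le> Z" using \<epsilon> by (simp_all add: Z_def)
  have sq: "Z \<le> Z\<^sup>2" "1 \<le> Z\<^sup>2" using Z(1) by (auto intro: self_le_power one_le_power)
  have mn: "real m * real n \<le> Z\<^sup>2"
    unfolding power2_eq_square using Z by (intro mult_mono) auto
  have "real K * (1 / \<epsilon>) ^ 3 \<le> Z * Z ^ 3"
    using Z K \<epsilon> by (intro mult_mono power_mono) auto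
  moreover have "real r \<le> 2001 * (real K * (1 / \<epsilon>) ^ 3)"
    using r by (simp add: divide_inverse mult.assoc flip: power_inverse)
  moreover have "Z * Z ^ 3 = Z ^ 4" by (simp flip: power_Suc)
  ultimately have "real r \<le> 2001 * Z ^ 4" by linarith
  then have "real r * (3 * (real m * real n) + 12 * real n + 5 * real m + 11) \<le> (2001 * Z ^ 4) * (31 * Z\<^sup>2)"
    using mn sq Z by (intro mult_mono) auto
  also have "\<dots> = 62031 * Z ^ 6" by (simp flip: power_add)
  finally have 1: "real r * (3 * (real m * real n) + 12 * real n + 5 * real m + 11) \<le> 62031 * Z ^ 6" .
  have "Z\<^sup>2 \<le> Z ^ 6" using Z by (intro power_increasing) auto
  then have "3 * real m + 7 * (real m * real n) + 8 * real n + 10 \<le> 28 * Z ^ 6"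
    using mn sq Z by linarith
  moreover have "0 \<le> Z ^ 6" using Z by simp
  ultimately have "3 * real m + 7 * (real m * real n) + 8 * real n + 10
      + real r * (3 * (real m * real n) + 12 * real n + 5 * real m + 11) \<le> 70000 * Z ^ 6"
    using 1 by linarith
  then show ?thesis by (simp add: Z_def algebra_simps)
qed

theorem theorem3:
  shows "\<exists>(P :: com) (C :: real) (q :: real poly).
    \<forall>(m :: nat) (n :: nat) (k :: nat) (A :: real mat) (b :: real vec) (\<epsilon>\<^sub>0 :: real) (\<epsilon> :: real).
      A \<in> carrier_mat m n \<and> 0\<^sub>m m n \<le> A \<and> b \<in> carrier_vec m \<and> 0\<^sub>v m \<le> b \<and>
      0 < \<epsilon>\<^sub>0 \<and> \<epsilon>\<^sub>0 < 1 / 16 \<and>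
      (\<exists>x. x \<in> carrier_vec n \<and> 0\<^sub>v n \<le> x \<and> sparse k x \<and>
           norm1 (A *\<^sub>v x) = norm1 b \<and> A *\<^sub>v x \<le> (1 + \<epsilon>\<^sub>0) \<cdot>\<^sub>v b) \<and>
      16 * \<epsilon>\<^sub>0 \<le> \<epsilon>
      \<longrightarrow> (\<exists>t s. exec P (input_state A b k \<epsilon>) t s \<and>
            real t \<le> poly q (real m + real n + 1 / \<epsilon>) \<and>
            real (nnz (output_vec n s)) \<le> C * real k / \<epsilon> ^ 3 \<and>
            norm1 (A *\<^sub>v output_vec n s - b) \<le> \<epsilon> * norm1 b)"
proof (rule exI[of _ solver], rule exI[of _ 2001], rule exI[of _ "smult 70000 ([:1, 1:] ^ 6)"],
    intro allI impI)
  fix m n k :: nat and A :: "real mat" and b :: "real vec" and \<epsilon>\<^sub>0 \<epsilon> :: real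
  assume H: "A \<in> carrier_mat m n \<and> 0\<^sub>m m n \<le> A \<and> b \<in> carrier_vec m \<and> 0\<^sub>v m \<le> b \<and>
      0 < \<epsilon>\<^sub>0 \<and> \<epsilon>\<^sub>0 < 1 / 16 \<and>
      (\<exists>x. x \<in> carrier_vec n \<and> 0\<^sub>v n \<le> x \<and> sparse k x \<and>
           norm1 (A *\<^sub>v x) = norm1 b \<and> A *\<^sub>v x \<le> (1 + \<epsilon>\<^sub>0) \<cdot>\<^sub>v b) \<and>
      16 * \<epsilon>\<^sub>0 \<le> \<epsilon>"
  from H obtain x where x: "x \<in> carrier_vec n" "0\<^sub>v n \<le> x" "sparse k x"
     "norm1 (A *\<^sub>v x) = norm1 b" "A *\<^sub>v x \<le> (1 + \<epsilon>\<^sub>0) \<cdot>\<^sub>v b" by (elim conjE exE)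
  from H have A: "A \<in> carrier_mat m n" "0\<^sub>m m n \<le> A" by blast+
  then have A_dim: "dim_row A = m" "dim_col A = n" by auto
  from A(2) have A0: "0 \<le> A $$ (i, j)" if "i < m" "j < n" for i j
    using that A_dim by (auto simp: less_eq_mat_def)
  from H have "b \<in> carrier_vec m" "0\<^sub>v m \<le> b" by blast+
  then have b: "dim_vec b = m" "\<And>i. i < m \<Longrightarrow> 0 \<le> b $ i"
    by (simp_all add: less_eq_vec_def)
  from x have x0: "dim_vec x = n" "\<And>j. j < n \<Longrightarrow> 0 \<le> x $ j"
    by (simp_all add: less_eq_vec_def)
  from H have \<epsilon>: "0 < \<epsilon>" "0 < \<epsilon>\<^sub>0" "16 * \<epsilon>\<^sub>0 \<le> \<epsilon>" by auto
  \<comment> \<open>Padding by zero matches the initial memory and gives nonnegativity at all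
    indices.\<close>
  define a where "a i j = (if i < m \<and> j < n then A $$ (i, j) else 0)" for i j
  define \<beta> where "\<beta> i = (if i < m then b $ i else 0)" for i
  define K where "K = min k n"
  interpret nonneg_system m n K a \<beta> \<epsilon> .
  have Ay: "(A *\<^sub>v y) $ i = (\<Sum>j<n. a i j * y $ j)" if "dim_vec y = n" "i < m" for y i
    unfolding mult_mat_vec_nth[OF A(1) that] using that by (intro sum.cong) (auto simp: a_def)
  have norm_b: "norm1 b = total"
    using b by (simp add: norm1_def total_def \<beta>_def)
  have err: "norm1 (A *\<^sub>v output_vec n s - b) = (\<Sum>i<m. \<bar>(\<Sum>j<n. a i j * snd s ''x'' j 0) - \<beta> i\<bar>)" for s
    using A_dim b by (simp add: norm1_def Ay output_vec_def \<beta>_def del: index_mult_mat_vec)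
  have nnz_out: "nnz (output_vec n s) = card {j. j < n \<and> snd s ''x'' j 0 \<noteq> 0}" for s
    unfolding nnz_def output_vec_def by (rule arg_cong[where f = card]) auto
  let ?s = "input_state A b k \<epsilon>"
  let ?good = "\<lambda>s. real (nnz (output_vec n s)) \<le> 2001 * real k / \<epsilon> ^ 3 \<and>
            norm1 (A *\<^sub>v output_vec n s - b) \<le> \<epsilon> * norm1 b"
  define R where "R = nat \<lceil>2000 * real K / \<epsilon> ^ 3\<rceil>"
  define T where "T = n * (7 * m + 8) + 2 + (R * (3 * m * n + 12 * n + 5 * m + 11) + 1)"
  have inp: "fst ?s ''m'' = m" "fst ?s ''n'' = n" "min (fst ?s ''k'') n = K" "fst ?s ''t'' = 0"
    "snd ?s ''A'' i j = a i j" "snd ?s ''b'' i 0 = \<beta> i" "snd ?s ''eps'' 0 0 = \<epsilon>"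
    "snd ?s ''x'' = (\<lambda>_ _. 0)" "snd ?s ''p'' = (\<lambda>_ _. 0)" "snd ?s ''w'' = (\<lambda>_ _. 0)" for i j
    using A_dim b by (auto simp: input_state_def a_def \<beta>_def K_def)
  show "\<exists>t s. exec solver ?s t s \<and>
            real t \<le> poly (smult 70000 ([:1, 1:] ^ 6)) (real m + real n + 1 / \<epsilon>) \<and>
            real (nnz (output_vec n s)) \<le> 2001 * real k / \<epsilon> ^ 3 \<and>
            norm1 (A *\<^sub>v output_vec n s - b) \<le> \<epsilon> * norm1 b"
  proof (cases "\<epsilon> < 1 \<and> 0 < total")
    case True
    have "sparse_system m n K a \<beta> \<epsilon> (\<lambda>j. x $ j) \<epsilon>\<^sub>0"
    proof
      show "card {j. j < n \<and> x $ j \<noteq> 0} \<le> K"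
      proof -
        have "card {j. j < n \<and> x $ j \<noteq> 0} \<le> card {..<n}" by (intro card_mono) auto
        then show ?thesis using x(3) x0 by (simp add: K_def sparse_def nnz_def)
      qed
      show "(\<Sum>j<n. colsum j * x $ j) = total"
      proof -
        have "norm1 (A *\<^sub>v x) = (\<Sum>i<m. \<bar>\<Sum>j<n. a i j * x $ j\<bar>)"
          using A_dim x0 by (simp add: norm1_def Ay del: index_mult_mat_vec)
        \<comment> \<open>Nonnegativity removes the absolute values, so the norm condition becomes
          one on column masses.\<close>
        also have "\<dots> = (\<Sum>i<m. \<Sum>j<n. a i j * x $ j)"
          using A0 x0 by (intro sum.cong abs_of_nonneg sum_nonneg) (auto simp: a_def)
        also have "\<dots> = (\<Sum>j<n. colsum j * x $ j)"
          by (subst sum.swap) (simp add: colsum_def sum_distrib_right)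
        finally show ?thesis using x(4) norm_b by simp
      qed
      show "(\<Sum>j<n. a i j * x $ j) \<le> (1 + \<epsilon>\<^sub>0) * \<beta> i" if "i < m" for i
      proof -
        have "(A *\<^sub>v x) $ i \<le> ((1 + \<epsilon>\<^sub>0) \<cdot>\<^sub>v b) $ i"
          using x(5) that A_dim b by (auto simp: less_eq_vec_def simp del: index_mult_mat_vec)
        then show ?thesis using that b Ay[OF x0(1) that] by (simp add: \<beta>_def del: index_mult_mat_vec)
      qed
    qed (use True A0 b x0 \<epsilon> in \<open>auto simp: a_def \<beta>_def\<close>)
    then interpret sparse_system m n K a \<beta> \<epsilon> "\<lambda>j. x $ j" \<epsilon>\<^sub>0 .
    have R: "R = rounds" by (simp add: R_def rounds_def)
    have "runs solver ?s (3 * m + 7 + T) (running R)"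
    proof (rule runs_solver[OF inp(1-3,5-7)])
      fix s' assume "agree {''i'', ''k''} {''s'', ''S''} ?s s'" "loaded s'"
      then show "runs (Seq columns_prog loop_prog) s' T (running R)"
        unfolding T_def R using inp by (intro runs_columns_loop) (simp_all add: agree_def)
    qed (use True in \<open>auto simp: T_def\<close>)
    then obtain t s where ts: "exec solver ?s t s" "t \<le> 3 * m + 7 + T" "running R s"
      unfolding runs_def by blast
    then have it: "iterate R (\<lambda>j. snd s ''x'' j 0) (\<lambda>i. snd s ''p'' i 0)" by (simp add: running_def)
    have "real t \<le> real (3 * m + 7 + T)" using ts(2) by (simp only: of_nat_le_iff)
    also have "\<dots> \<le> 70000 * (1 + (real m + real n + 1 / \<epsilon>)) ^ 6"
      unfolding T_def using \<epsilon>(1) rounds_le by (intro time_bound) (auto simp: K_def R)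
    finally have "real t \<le> poly (smult 70000 ([:1, 1:] ^ 6)) (real m + real n + 1 / \<epsilon>)" by simp
    moreover have "real (nnz (output_vec n s)) \<le> 2001 * real k / \<epsilon> ^ 3"
    proof -
      have "real (nnz (output_vec n s)) \<le> real rounds"
        using it by (simp add: nnz_out iterate_def R)
      also note rounds_le
      also have "2001 * real K / \<epsilon> ^ 3 \<le> 2001 * real k / \<epsilon> ^ 3"
        using \<epsilon> by (intro divide_right_mono) (auto simp: K_def)
      finally show ?thesis .
    qed
    moreover have "norm1 (A *\<^sub>v output_vec n s - b) \<le> \<epsilon> * norm1 b"
      unfolding err norm_b
      using less_rounds_iff[of R] by (intro iterate_error[OF it]) (simp add: R)
    ultimately show ?thesis using ts(1) by blast
  next
    case False
    have "runs solver ?s (3 * m + 7 + 1) (\<lambda>s. snd s ''x'' = (\<lambda>_ _. 0))"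
      by (rule runs_solver[OF inp(1-3,5-7)]) (use False inp(8) in \<open>auto simp: agree_def\<close>)
    then obtain t s where ts: "exec solver ?s t s" "t \<le> 3 * m + 7 + 1" "snd s ''x'' = (\<lambda>_ _. 0)"
      unfolding runs_def by blast
    have "real t \<le> real (3 * m + 7 + (n * (7 * m + 8) + 2 + (0 * (3 * m * n + 12 * n + 5 * m + 11) + 1)))"
      unfolding of_nat_le_iff using ts(2) by simp
    also have "\<dots> \<le> 70000 * (1 + (real m + real n + 1 / \<epsilon>)) ^ 6"
      using \<epsilon>(1) by (intro time_bound[where K = 0]) auto
    finally have "real t \<le> poly (smult 70000 ([:1, 1:] ^ 6)) (real m + real n + 1 / \<epsilon>)" by simp
    moreover have "real (nnz (output_vec n s)) \<le> 2001 * real k / \<epsilon> ^ 3"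
      using \<epsilon> by (simp add: nnz_out ts(3))
    moreover have "norm1 (A *\<^sub>v output_vec n s - b) \<le> \<epsilon> * norm1 b"
    proof -
      \<comment> \<open>The zero vector has error \<open>total\<close>, which is at most
        \<open>\<epsilon> * total\<close> when \<epsilon> >= 1 or \<open>total = 0\<close>.\<close>
      have "0 \<le> total" unfolding total_def using b by (intro sum_nonneg) (auto simp: \<beta>_def)
      then have "total \<le> \<epsilon> * total"
        using False mult_right_mono[of 1 \<epsilon> total] by (cases "total = 0") auto
      then show ?thesis unfolding err norm_b using b by (simp add: ts(3) total_def \<beta>_def)
    qed
    ultimately show ?thesis using ts(1) by blast
  qed
qed

end
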